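(* Let $(\mathfrak g,[\cdot,\cdot],[\![\cdot,\cdot,\cdot]\!])$ be a Lie-Yamaguti algebra with a representation $(V;\rho,\mu)$. Suppose two linear deformations $(\mathfrak g,[\cdot,\cdot]_t,[\![\cdot,\cdot,\cdot]\!]_t;\rho_t,\mu_t)$ and $(\mathfrak g,[\cdot,\cdot]'_t,[\![\cdot,\cdot,\cdot]\!]'_t;\rho'_t,\mu'_t)$ of the pair $(\mathfrak g,\rho,\mu)$, generated by $(\phi,\varphi_i;\varrho,\varpi_i)$ and $(\phi',\varphi'_i;\varrho',\varpi'_i)$ $(i=1,2)$ respectively, are equivalent. Then $(\phi+\varrho,\varphi_1+\varpi_1)$ and $(\phi'+\varrho',\varphi'_1+\varpi'_1)$ are in the same cohomology class of $\mathcal H^2(\mathfrak g,\rho,\mu)$.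
   Context: All vector spaces are finite-dimensional over a field $\mathbb K$ of characteristic $0$. A Lie-Yamaguti algebra is a vector space $\mathfrak g$ with a bilinear map $[\cdot,\cdot]:\wedge^2\mathfrak g\to\mathfrak g$ and a trilinear map $[\![\cdot,\cdot,\cdot]\!]:\wedge^2\mathfrak g\otimes\mathfrak g\to\mathfrak g$ such that for all $x,y,z,w,t\in\mathfrak g$: (1) $[[x,y],z]+[[y,z],x]+[[z,x],y]+[\![x,y,z]\!]+[\![y,z,x]\!]+[\![z,x,y]\!]=0$; (2) $[\![[x,y],z,w]\!]+[\![[y,z],x,w]\!]+[\![[z,x],y,w]\!]=0$; (3) $[\![x,y,[z,w]]\!]=[[\![x,y,z]\!],w]+[z,[\![x,y,w]\!]]$; (4) $[\![x,y,[\![z,w,t]\!]]\!]=[\![[\![x,y,z]\!],w,t]\!]+[\![z,[\![x,y,w]\!],t]\!]+[\![z,w,[\![x,y,t]\!]]\!]$. A representation $(V;\rho,\mu)$ of $\mathfrak g$ is a vector space $V$ with linear maps $\rho:\mathfrak g\to\mathfrak{gl}(V)$, $\mu:\otimes^2\mathfrak g\to\mathfrak{gl}(V)$ such that, with $D(x,y)=D_{\rho,\mu}(x,y):=\mu(y,x)-\mu(x,y)+[\rho(x),\rho(y)]-\rho([x,y])$, for all $x,y,z,w\in\mathfrak g$: $\mu([x,y],z)-\mu(x,z)\rho(y)+\mu(y,z)\rho(x)=0$; $\mu(x,[y,z])-\rho(y)\mu(x,z)+\rho(z)\mu(x,y)=0$; $\rho([\![x,y,z]\!])=[D(x,y),\rho(z)]$;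 $\mu(z,w)\mu(x,y)-\mu(y,w)\mu(x,z)-\mu(x,[\![y,z,w]\!])+D(y,z)\mu(x,w)=0$; $\mu([\![x,y,z]\!],w)+\mu(z,[\![x,y,w]\!])=[D(x,y),\mu(z,w)]$. A Lie-Yamaguti algebra together with a representation is called a LieYRep pair, also denoted $(\mathfrak g,\rho,\mu)$. Linear deformations: given linear maps $\phi:\wedge^2\mathfrak g\to\mathfrak g$, $\varphi_i:\wedge^2\mathfrak g\otimes\mathfrak g\to\mathfrak g$, $\varrho:\mathfrak g\to\mathfrak{gl}(V)$, $\varpi_i:\otimes^2\mathfrak g\to\mathfrak{gl}(V)$ ($i=1,2$), put $[x,y]_t=[x,y]+t\phi(x,y)$, $[\![x,y,z]\!]_t=[\![x,y,z]\!]+t\varphi_1(x,y,z)+t^2\varphi_2(x,y,z)$, $\rho_t(x)=\rho(x)+t\varrho(x)$, $\mu_t(x,y)=\mu(x,y)+t\varpi_1(x,y)+t^2\varpi_2(x,y)$. If $((\mathfrak g,[\cdot,\cdot]_t,[\![\cdot,\cdot,\cdot]\!]_t),(V;\rho_t,\mu_t))$ is a LieYRep pair for all $t$, then $(\phi,\varphi_i;\varrho,\varpi_i)$ is said to generate a linear deformation of $(\mathfrak g,\rho,\mu)$. One has $D_{\rho_t,\mu_t}=D+t\mathcal D_1+t^2\mathcal D_2$ with $\mathcal D_1(x,y)=\varpi_1(y,x)-\varpi_1(x,y)+[\rho(x),\varrho(y)]+[\varrho(x),\rho(y)]-\varrho([x,y])-\rho(\phi(x,y))$. Homomorphisms of LieYRep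 pairs from $(\mathfrak g,\rho_V,\mu_V)$ to $(\mathfrak h,\rho_W,\mu_W)$: pairs $(\alpha,\beta)$ with $\alpha:\mathfrak g\to\mathfrak h$ linear preserving both brackets and $\beta:V\to W$ linear with $\beta(\rho_V(x)v)=\rho_W(\alpha(x))\beta(v)$, $\beta(\mu_V(x,y)v)=\mu_W(\alpha(x),\alpha(y))\beta(v)$. Two linear deformations are equivalent if there are $N\in\mathfrak{gl}(\mathfrak g)$, $S\in\mathfrak{gl}(V)$ such that $(\mathrm{Id}_{\mathfrak g}+tN,\mathrm{Id}_V+tS)$ is an isomorphism from the primed deformation to the unprimed one; this is understood as: it is a homomorphism for all $t$ (hence an isomorphism whenever $\mathrm{Id}_{\mathfrak g}+tN$ and $\mathrm{Id}_V+tS$ are invertible). Semidirect product $\mathfrak g\ltimes V$: $\mathfrak g\oplus V$ with $[x+u,y+v]_\ltimes=[x,y]+\rho(x)v-\rho(y)u$, $[\![x+u,y+v,z+w]\!]_\ltimes=[\![x,y,z]\!]+D(x,y)w+\mu(y,z)u-\mu(x,z)v$; it is a Lie-Yamaguti algebra $L$. Cohomology used: for a Lie-Yamaguti algebra $L$ (adjoint coefficients), $1$-cochains are $f\in\mathrm{Hom}(L,L)$, and $2$-cochains are pairs $(f,g)\in\mathrm{Hom}(\wedge^2L,L)\times\mathrm{Hom}(\wedge^2L\otimes L,L)$. For a $1$-cochain, $\delta f=(\delta_{\rm I}f,\delta_{\rm II}f)$ with $\delta_{\rm I}f(a,b)=[a,f(b)]-[b,f(a)]-f([a,b])$ and $\delta_{\rm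 II}f(a,b,c)=[\![a,b,f(c)]\!]+[\![f(a),b,c]\!]-[\![f(b),a,c]\!]-f([\![a,b,c]\!])$. For a $2$-cochain, $\delta(f,g)=(\delta_{\rm I}(f,g),\delta_{\rm II}(f,g))$ with $\delta_{\rm I}(f,g)(a,b,c,d)=-\big([c,g(a,b,d)]-[d,g(a,b,c)]-g(a,b,[c,d])\big)+[\![a,b,f(c,d)]\!]-f([\![a,b,c]\!],d)-f(c,[\![a,b,d]\!])$, $\delta_{\rm II}(f,g)(a,b,c,d,e)=-\big([\![g(a,b,c),d,e]\!]-[\![g(a,b,d),c,e]\!]\big)+[\![a,b,g(c,d,e)]\!]-[\![c,d,g(a,b,e)]\!]-g([\![a,b,c]\!],d,e)-g(c,[\![a,b,d]\!],e)-g(c,d,[\![a,b,e]\!])+g(a,b,[\![c,d,e]\!])$. For the pair $(\mathfrak g,\rho,\mu)$: $\mathcal C^1(\mathfrak g,\rho,\mu)=\mathfrak{gl}(\mathfrak g)\times\mathfrak{gl}(V)$, embedded in $1$-cochains of $L=\mathfrak g\ltimes V$ by $(N,S)(x+u)=Nx+Su$; $\mathcal C^2(\mathfrak g,\rho,\mu)$ is the space of $2$-cochains of $L$ which send inputs all in $\mathfrak g$ to $\mathfrak g$, inputs with exactly one entry in $V$ (the others in $\mathfrak g$) to $V$, and vanish if two or more entries are in $V$. $\Delta$ is the restriction of $\delta$; $\mathcal Z^2(\mathfrak g,\rho,\mu)=\{c\in\mathcal C^2:\Delta c=0\}$, $\mathcal B^2(\mathfrak g,\rho,\mu)=\Delta(\mathcal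 C^1)$, $\mathcal H^2=\mathcal Z^2/\mathcal B^2$. The symbol $(\phi+\varrho,\varphi_1+\varpi_1)$ denotes the element of $\mathcal C^2(\mathfrak g,\rho,\mu)$ given by $(\phi+\varrho)(x+u,y+v)=\phi(x,y)+\varrho(x)v-\varrho(y)u$ and $(\varphi_1+\varpi_1)(x+u,y+v,z+w)=\varphi_1(x,y,z)+\mathcal D_1(x,y)w+\varpi_1(y,z)u-\varpi_1(x,z)v$; similarly for the primed maps. *)

theory Defs
  imports "HOL-Analysis.Product_Vector" "HOL-Library.Function_Algebras"
begin

text \<open>
  A vector space is given by its scalar multiplication on a whole type, as in the locale
  \<^locale>\<open>vector_space\<close>. Sums, differences and zero of linear operators and of cochains are the
  pointwise ones of \<^theory>\<open>HOL-Library.Function_Algebras\<close>.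
\<close>

definition bilinear_map ::
  "('k::field \<Rightarrow> 'a::ab_group_add \<Rightarrow> 'a) \<Rightarrow> ('k \<Rightarrow> 'b::ab_group_add \<Rightarrow> 'b)
    \<Rightarrow> ('k \<Rightarrow> 'c::ab_group_add \<Rightarrow> 'c) \<Rightarrow> ('a \<Rightarrow> 'b \<Rightarrow> 'c) \<Rightarrow> bool" where
  "bilinear_map s1 s2 s3 f \<longleftrightarrow>
     (\<forall>x. Vector_Spaces.linear s2 s3 (f x)) \<and>
     (\<forall>y. Vector_Spaces.linear s1 s3 (\<lambda>x. f x y))"

definition trilinear_map ::
  "('k::field \<Rightarrow> 'a::ab_group_add \<Rightarrow> 'a) \<Rightarrow> ('k \<Rightarrow> 'b::ab_group_add \<Rightarrow> 'b)
    \<Rightarrow> ('k \<Rightarrow> 'c::ab_group_add \<Rightarrow> 'c) \<Rightarrow> ('k \<Rightarrow> 'd::ab_group_add \<Rightarrow> 'd)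
    \<Rightarrow> ('a \<Rightarrow> 'b \<Rightarrow> 'c \<Rightarrow> 'd) \<Rightarrow> bool" where
  "trilinear_map s1 s2 s3 s4 f \<longleftrightarrow>
     (\<forall>x y. Vector_Spaces.linear s3 s4 (f x y)) \<and>
     (\<forall>x z. Vector_Spaces.linear s2 s4 (\<lambda>y. f x y z)) \<and>
     (\<forall>y z. Vector_Spaces.linear s1 s4 (\<lambda>x. f x y z))"

text \<open>Linear maps \<open>\<wedge>\<^sup>2\<gg> \<rightarrow> \<gg>\<close> and \<open>\<wedge>\<^sup>2\<gg> \<otimes> \<gg> \<rightarrow> \<gg>\<close>, as alternating multilinear maps.\<close>

definition alt_bilinear ::
  "('k::field \<Rightarrow> 'a::ab_group_add \<Rightarrow> 'a) \<Rightarrow> ('a \<Rightarrow> 'a \<Rightarrow> 'a) \<Rightarrow> bool" where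
  "alt_bilinear s f \<longleftrightarrow> bilinear_map s s s f \<and> (\<forall>x. f x x = 0)"

definition alt_trilinear ::
  "('k::field \<Rightarrow> 'a::ab_group_add \<Rightarrow> 'a) \<Rightarrow> ('a \<Rightarrow> 'a \<Rightarrow> 'a \<Rightarrow> 'a) \<Rightarrow> bool" where
  "alt_trilinear s f \<longleftrightarrow> trilinear_map s s s s f \<and> (\<forall>x z. f x x z = 0)"

definition lie_yamaguti ::
  "('k::field \<Rightarrow> 'a::ab_group_add \<Rightarrow> 'a) \<Rightarrow> ('a \<Rightarrow> 'a \<Rightarrow> 'a) \<Rightarrow> ('a \<Rightarrow> 'a \<Rightarrow> 'a \<Rightarrow> 'a) \<Rightarrow> bool" where
  "lie_yamaguti s br tr \<longleftrightarrow>
     alt_bilinear s br \<and> alt_trilinear s tr \<and>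
     (\<forall>x y z. br (br x y) z + br (br y z) x + br (br z x) y + tr x y z + tr y z x + tr z x y = 0) \<and>
     (\<forall>x y z w. tr (br x y) z w + tr (br y z) x w + tr (br z x) y w = 0) \<and>
     (\<forall>x y z w. tr x y (br z w) = br (tr x y z) w + br z (tr x y w)) \<and>
     (\<forall>x y z w t. tr x y (tr z w t) = tr (tr x y z) w t + tr z (tr x y w) t + tr z w (tr x y t))"

definition commutator :: "('v \<Rightarrow> 'v) \<Rightarrow> ('v \<Rightarrow> 'v) \<Rightarrow> ('v::ab_group_add \<Rightarrow> 'v)" where
  "commutator A B = (A \<circ> B) - (B \<circ> A)"

definition D_op ::
  "('a \<Rightarrow> 'a \<Rightarrow> 'a) \<Rightarrow> ('a \<Rightarrow> 'v \<Rightarrow> 'v) \<Rightarrow> ('a \<Rightarrow> 'a \<Rightarrow> 'v \<Rightarrow> 'v)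
    \<Rightarrow> 'a \<Rightarrow> 'a \<Rightarrow> 'v \<Rightarrow> 'v::ab_group_add" where
  "D_op br \<rho> \<mu> x y = \<mu> y x - \<mu> x y + commutator (\<rho> x) (\<rho> y) - \<rho> (br x y)"

definition ly_representation ::
  "('k::field \<Rightarrow> 'a::ab_group_add \<Rightarrow> 'a) \<Rightarrow> ('k \<Rightarrow> 'v::ab_group_add \<Rightarrow> 'v)
    \<Rightarrow> ('a \<Rightarrow> 'a \<Rightarrow> 'a) \<Rightarrow> ('a \<Rightarrow> 'a \<Rightarrow> 'a \<Rightarrow> 'a)
    \<Rightarrow> ('a \<Rightarrow> 'v \<Rightarrow> 'v) \<Rightarrow> ('a \<Rightarrow> 'a \<Rightarrow> 'v \<Rightarrow> 'v) \<Rightarrow> bool" where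
  "ly_representation sg sv br tr \<rho> \<mu> \<longleftrightarrow>
     bilinear_map sg sv sv \<rho> \<and> trilinear_map sg sg sv sv \<mu> \<and>
     (let D = D_op br \<rho> \<mu> in
       (\<forall>x y z. \<mu> (br x y) z - (\<mu> x z \<circ> \<rho> y) + (\<mu> y z \<circ> \<rho> x) = 0) \<and>
       (\<forall>x y z. \<mu> x (br y z) - (\<rho> y \<circ> \<mu> x z) + (\<rho> z \<circ> \<mu> x y) = 0) \<and>
       (\<forall>x y z. \<rho> (tr x y z) = commutator (D x y) (\<rho> z)) \<and>
       (\<forall>x y z w. (\<mu> z w \<circ> \<mu> x y) - (\<mu> y w \<circ> \<mu> x z) - \<mu> x (tr y z w) + (D y z \<circ> \<mu> x w) = 0) \<and>
       (\<forall>x y z w. \<mu> (tr x y z) w + \<mu> z (tr x y w) = commutator (D x y) (\<mu> z w)))"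

definition lieyrep_pair ::
  "('k::field \<Rightarrow> 'a::ab_group_add \<Rightarrow> 'a) \<Rightarrow> ('k \<Rightarrow> 'v::ab_group_add \<Rightarrow> 'v)
    \<Rightarrow> ('a \<Rightarrow> 'a \<Rightarrow> 'a) \<Rightarrow> ('a \<Rightarrow> 'a \<Rightarrow> 'a \<Rightarrow> 'a)
    \<Rightarrow> ('a \<Rightarrow> 'v \<Rightarrow> 'v) \<Rightarrow> ('a \<Rightarrow> 'a \<Rightarrow> 'v \<Rightarrow> 'v) \<Rightarrow> bool" where
  "lieyrep_pair sg sv br tr \<rho> \<mu> \<longleftrightarrow> lie_yamaguti sg br tr \<and> ly_representation sg sv br tr \<rho> \<mu>"

definition lieyrep_hom ::
  "('k::field \<Rightarrow> 'a::ab_group_add \<Rightarrow> 'a) \<Rightarrow> ('k \<Rightarrow> 'v::ab_group_add \<Rightarrow> 'v)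
    \<Rightarrow> ('a \<Rightarrow> 'a \<Rightarrow> 'a) \<Rightarrow> ('a \<Rightarrow> 'a \<Rightarrow> 'a \<Rightarrow> 'a)
    \<Rightarrow> ('a \<Rightarrow> 'v \<Rightarrow> 'v) \<Rightarrow> ('a \<Rightarrow> 'a \<Rightarrow> 'v \<Rightarrow> 'v)
    \<Rightarrow> ('k \<Rightarrow> 'b::ab_group_add \<Rightarrow> 'b) \<Rightarrow> ('k \<Rightarrow> 'w::ab_group_add \<Rightarrow> 'w)
    \<Rightarrow> ('b \<Rightarrow> 'b \<Rightarrow> 'b) \<Rightarrow> ('b \<Rightarrow> 'b \<Rightarrow> 'b \<Rightarrow> 'b)
    \<Rightarrow> ('b \<Rightarrow> 'w \<Rightarrow> 'w) \<Rightarrow> ('b \<Rightarrow> 'b \<Rightarrow> 'w \<Rightarrow> 'w)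
    \<Rightarrow> ('a \<Rightarrow> 'b) \<Rightarrow> ('v \<Rightarrow> 'w) \<Rightarrow> bool" where
  "lieyrep_hom sg sv br tr \<rho> \<mu> sh sw br' tr' \<rho>' \<mu>' \<alpha> \<beta> \<longleftrightarrow>
     Vector_Spaces.linear sg sh \<alpha> \<and> Vector_Spaces.linear sv sw \<beta> \<and>
     (\<forall>x y. \<alpha> (br x y) = br' (\<alpha> x) (\<alpha> y)) \<and>
     (\<forall>x y z. \<alpha> (tr x y z) = tr' (\<alpha> x) (\<alpha> y) (\<alpha> z)) \<and>
     (\<forall>x v. \<beta> (\<rho> x v) = \<rho>' (\<alpha> x) (\<beta> v)) \<and>
     (\<forall>x y v. \<beta> (\<mu> x y v) = \<mu>' (\<alpha> x) (\<alpha> y) (\<beta> v))"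

text \<open>
  \<open>deform1\<close> gives both \<open>[x,y]\<^sub>t\<close> and \<open>\<rho>\<^sub>t(x)v\<close>; \<open>deform2\<close> gives both the deformed
  ternary bracket and \<open>\<mu>\<^sub>t(x,y)v\<close>.
\<close>

definition deform1 ::
  "('k::field \<Rightarrow> 'c::ab_group_add \<Rightarrow> 'c) \<Rightarrow> ('a \<Rightarrow> 'b \<Rightarrow> 'c) \<Rightarrow> ('a \<Rightarrow> 'b \<Rightarrow> 'c)
    \<Rightarrow> 'k \<Rightarrow> 'a \<Rightarrow> 'b \<Rightarrow> 'c" where
  "deform1 s f f\<^sub>1 t = (\<lambda>x y. f x y + s t (f\<^sub>1 x y))"

definition deform2 ::
  "('k::field \<Rightarrow> 'd::ab_group_add \<Rightarrow> 'd) \<Rightarrow> ('a \<Rightarrow> 'b \<Rightarrow> 'c \<Rightarrow> 'd) \<Rightarrow> ('a \<Rightarrow> 'b \<Rightarrow> 'c \<Rightarrow> 'd)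
    \<Rightarrow> ('a \<Rightarrow> 'b \<Rightarrow> 'c \<Rightarrow> 'd) \<Rightarrow> 'k \<Rightarrow> 'a \<Rightarrow> 'b \<Rightarrow> 'c \<Rightarrow> 'd" where
  "deform2 s f f\<^sub>1 f\<^sub>2 t = (\<lambda>x y z. f x y z + s t (f\<^sub>1 x y z) + s (t ^ 2) (f\<^sub>2 x y z))"

definition generates_linear_deformation ::
  "('k::field \<Rightarrow> 'a::ab_group_add \<Rightarrow> 'a) \<Rightarrow> ('k \<Rightarrow> 'v::ab_group_add \<Rightarrow> 'v)
    \<Rightarrow> ('a \<Rightarrow> 'a \<Rightarrow> 'a) \<Rightarrow> ('a \<Rightarrow> 'a \<Rightarrow> 'a \<Rightarrow> 'a)
    \<Rightarrow> ('a \<Rightarrow> 'v \<Rightarrow> 'v) \<Rightarrow> ('a \<Rightarrow> 'a \<Rightarrow> 'v \<Rightarrow> 'v)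
    \<Rightarrow> ('a \<Rightarrow> 'a \<Rightarrow> 'a) \<Rightarrow> ('a \<Rightarrow> 'a \<Rightarrow> 'a \<Rightarrow> 'a) \<Rightarrow> ('a \<Rightarrow> 'a \<Rightarrow> 'a \<Rightarrow> 'a)
    \<Rightarrow> ('a \<Rightarrow> 'v \<Rightarrow> 'v) \<Rightarrow> ('a \<Rightarrow> 'a \<Rightarrow> 'v \<Rightarrow> 'v) \<Rightarrow> ('a \<Rightarrow> 'a \<Rightarrow> 'v \<Rightarrow> 'v) \<Rightarrow> bool" where
  "generates_linear_deformation sg sv br tr \<rho> \<mu> \<phi> \<phi>\<^sub>1 \<phi>\<^sub>2 \<sigma> \<omega>\<^sub>1 \<omega>\<^sub>2 \<longleftrightarrow>
     alt_bilinear sg \<phi> \<and> alt_trilinear sg \<phi>\<^sub>1 \<and> alt_trilinear sg \<phi>\<^sub>2 \<and>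
     bilinear_map sg sv sv \<sigma> \<and> trilinear_map sg sg sv sv \<omega>\<^sub>1 \<and> trilinear_map sg sg sv sv \<omega>\<^sub>2 \<and>
     (\<forall>t. lieyrep_pair sg sv (deform1 sg br \<phi> t) (deform2 sg tr \<phi>\<^sub>1 \<phi>\<^sub>2 t)
            (deform1 sv \<rho> \<sigma> t) (deform2 sv \<mu> \<omega>\<^sub>1 \<omega>\<^sub>2 t))"

text \<open>
  Equivalence asks for \<open>(Id + tN, Id + tS)\<close> to be a homomorphism, from the primed deformation to
  the unprimed one, for every \<open>t\<close>; it need not be invertible for the finitely many exceptional \<open>t\<close>.
\<close>

definition equivalent_deformations ::
  "('k::field \<Rightarrow> 'a::ab_group_add \<Rightarrow> 'a) \<Rightarrow> ('k \<Rightarrow> 'v::ab_group_add \<Rightarrow> 'v)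
    \<Rightarrow> ('a \<Rightarrow> 'a \<Rightarrow> 'a) \<Rightarrow> ('a \<Rightarrow> 'a \<Rightarrow> 'a \<Rightarrow> 'a)
    \<Rightarrow> ('a \<Rightarrow> 'v \<Rightarrow> 'v) \<Rightarrow> ('a \<Rightarrow> 'a \<Rightarrow> 'v \<Rightarrow> 'v)
    \<Rightarrow> ('a \<Rightarrow> 'a \<Rightarrow> 'a) \<Rightarrow> ('a \<Rightarrow> 'a \<Rightarrow> 'a \<Rightarrow> 'a) \<Rightarrow> ('a \<Rightarrow> 'a \<Rightarrow> 'a \<Rightarrow> 'a)
    \<Rightarrow> ('a \<Rightarrow> 'v \<Rightarrow> 'v) \<Rightarrow> ('a \<Rightarrow> 'a \<Rightarrow> 'v \<Rightarrow> 'v) \<Rightarrow> ('a \<Rightarrow> 'a \<Rightarrow> 'v \<Rightarrow> 'v)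
    \<Rightarrow> ('a \<Rightarrow> 'a \<Rightarrow> 'a) \<Rightarrow> ('a \<Rightarrow> 'a \<Rightarrow> 'a \<Rightarrow> 'a) \<Rightarrow> ('a \<Rightarrow> 'a \<Rightarrow> 'a \<Rightarrow> 'a)
    \<Rightarrow> ('a \<Rightarrow> 'v \<Rightarrow> 'v) \<Rightarrow> ('a \<Rightarrow> 'a \<Rightarrow> 'v \<Rightarrow> 'v) \<Rightarrow> ('a \<Rightarrow> 'a \<Rightarrow> 'v \<Rightarrow> 'v) \<Rightarrow> bool" where
  "equivalent_deformations sg sv br tr \<rho> \<mu> \<phi> \<phi>\<^sub>1 \<phi>\<^sub>2 \<sigma> \<omega>\<^sub>1 \<omega>\<^sub>2 \<phi>' \<phi>\<^sub>1' \<phi>\<^sub>2' \<sigma>' \<omega>\<^sub>1' \<omega>\<^sub>2' \<longleftrightarrow>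
     (\<exists>N S. Vector_Spaces.linear sg sg N \<and> Vector_Spaces.linear sv sv S \<and>
       (\<forall>t. lieyrep_hom
              sg sv (deform1 sg br \<phi>' t) (deform2 sg tr \<phi>\<^sub>1' \<phi>\<^sub>2' t)
                    (deform1 sv \<rho> \<sigma>' t) (deform2 sv \<mu> \<omega>\<^sub>1' \<omega>\<^sub>2' t)
              sg sv (deform1 sg br \<phi> t) (deform2 sg tr \<phi>\<^sub>1 \<phi>\<^sub>2 t)
                    (deform1 sv \<rho> \<sigma> t) (deform2 sv \<mu> \<omega>\<^sub>1 \<omega>\<^sub>2 t)
              (\<lambda>x. x + sg t (N x)) (\<lambda>v. v + sv t (S v))))"

text \<open>The coefficient of \<open>t\<close> in \<open>D\<close> for the deformed pair.\<close>

definition D_op1 ::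
  "('a \<Rightarrow> 'a \<Rightarrow> 'a) \<Rightarrow> ('a \<Rightarrow> 'v \<Rightarrow> 'v) \<Rightarrow> ('a \<Rightarrow> 'a \<Rightarrow> 'a) \<Rightarrow> ('a \<Rightarrow> 'v \<Rightarrow> 'v)
    \<Rightarrow> ('a \<Rightarrow> 'a \<Rightarrow> 'v \<Rightarrow> 'v) \<Rightarrow> 'a \<Rightarrow> 'a \<Rightarrow> 'v \<Rightarrow> 'v::ab_group_add" where
  "D_op1 br \<rho> \<phi> \<sigma> \<omega>\<^sub>1 x y =
     \<omega>\<^sub>1 y x - \<omega>\<^sub>1 x y + commutator (\<rho> x) (\<sigma> y) + commutator (\<sigma> x) (\<rho> y)
       - \<sigma> (br x y) - \<rho> (\<phi> x y)"

text \<open>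
  \<open>sd_bin\<close> and \<open>sd_ter\<close> combine maps on \<open>\<gg>\<close> and on \<open>V\<close> into maps on \<open>\<gg> \<oplus> V\<close>. They yield the
  brackets of the semidirect product and also the cochains \<open>\<phi> + \<sigma>\<close> and \<open>\<phi>\<^sub>1 + \<omega>\<^sub>1\<close>.
\<close>

fun sd_bin :: "('a \<Rightarrow> 'a \<Rightarrow> 'a) \<Rightarrow> ('a \<Rightarrow> 'v \<Rightarrow> 'v) \<Rightarrow> 'a \<times> 'v \<Rightarrow> 'a \<times> 'v \<Rightarrow> 'a \<times> 'v::ab_group_add"
  where "sd_bin f r (x, u) (y, v) = (f x y, r x v - r y u)"

fun sd_ter :: "('a \<Rightarrow> 'a \<Rightarrow> 'a \<Rightarrow> 'a) \<Rightarrow> ('a \<Rightarrow> 'a \<Rightarrow> 'v \<Rightarrow> 'v) \<Rightarrow> ('a \<Rightarrow> 'a \<Rightarrow> 'v \<Rightarrow> 'v)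
    \<Rightarrow> 'a \<times> 'v \<Rightarrow> 'a \<times> 'v \<Rightarrow> 'a \<times> 'v \<Rightarrow> 'a \<times> 'v::ab_group_add"
  where "sd_ter g D m (x, u) (y, v) (z, w) = (g x y z, D x y w + m y z u - m x z v)"

type_synonym 'l cochain2 = "('l \<Rightarrow> 'l \<Rightarrow> 'l) \<times> ('l \<Rightarrow> 'l \<Rightarrow> 'l \<Rightarrow> 'l)"
type_synonym 'l cochain3 = "('l \<Rightarrow> 'l \<Rightarrow> 'l \<Rightarrow> 'l \<Rightarrow> 'l) \<times> ('l \<Rightarrow> 'l \<Rightarrow> 'l \<Rightarrow> 'l \<Rightarrow> 'l \<Rightarrow> 'l)"

definition cobd1 ::
  "('l \<Rightarrow> 'l \<Rightarrow> 'l) \<Rightarrow> ('l \<Rightarrow> 'l \<Rightarrow> 'l \<Rightarrow> 'l) \<Rightarrow> ('l \<Rightarrow> 'l) \<Rightarrow> 'l::ab_group_add cochain2" where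
  "cobd1 br tr f =
     ((\<lambda>a b. br a (f b) - br b (f a) - f (br a b)),
      (\<lambda>a b c. tr a b (f c) + tr (f a) b c - tr (f b) a c - f (tr a b c)))"

fun cobd2 ::
  "('l \<Rightarrow> 'l \<Rightarrow> 'l) \<Rightarrow> ('l \<Rightarrow> 'l \<Rightarrow> 'l \<Rightarrow> 'l) \<Rightarrow> 'l::ab_group_add cochain2 \<Rightarrow> 'l cochain3" where
  "cobd2 br tr (f, g) =
     ((\<lambda>a b c d. - (br c (g a b d) - br d (g a b c) - g a b (br c d))
         + tr a b (f c d) - f (tr a b c) d - f c (tr a b d)),
      (\<lambda>a b c d e. - (tr (g a b c) d e - tr (g a b d) c e)
         + tr a b (g c d e) - tr c d (g a b e)
         - g (tr a b c) d e - g c (tr a b d) e - g c d (tr a b e) + g a b (tr c d e)))"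

definition C1_pair ::
  "('k::field \<Rightarrow> 'a::ab_group_add \<Rightarrow> 'a) \<Rightarrow> ('k \<Rightarrow> 'v::ab_group_add \<Rightarrow> 'v)
    \<Rightarrow> ('a \<times> 'v \<Rightarrow> 'a \<times> 'v) set" where
  "C1_pair sg sv =
     {map_prod N S | N S. Vector_Spaces.linear sg sg N \<and> Vector_Spaces.linear sv sv S}"

text \<open>
  The conditions following multilinearity: inputs in \<open>\<gg>\<close> are sent to \<open>\<gg>\<close>, inputs with exactly
  one entry in \<open>V\<close> are sent to \<open>V\<close>, and the maps vanish as soon as two inputs are in \<open>V\<close>.
\<close>

definition C2_pair ::
  "('k::field \<Rightarrow> 'a::ab_group_add \<Rightarrow> 'a) \<Rightarrow> ('k \<Rightarrow> 'v::ab_group_add \<Rightarrow> 'v)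
    \<Rightarrow> ('a \<times> 'v) cochain2 set" where
  "C2_pair sg sv = {(f, g).
     alt_bilinear (module_prod.scale sg sv) f \<and> alt_trilinear (module_prod.scale sg sv) g \<and>
     (\<forall>x y. snd (f (x, 0) (y, 0)) = 0) \<and>
     (\<forall>x v. fst (f (x, 0) (0, v)) = 0) \<and> (\<forall>u y. fst (f (0, u) (y, 0)) = 0) \<and>
     (\<forall>u v. f (0, u) (0, v) = 0) \<and>
     (\<forall>x y z. snd (g (x, 0) (y, 0) (z, 0)) = 0) \<and>
     (\<forall>x y w. fst (g (x, 0) (y, 0) (0, w)) = 0) \<and>
     (\<forall>x v z. fst (g (x, 0) (0, v) (z, 0)) = 0) \<and>
     (\<forall>u y z. fst (g (0, u) (y, 0) (z, 0)) = 0) \<and>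
     (\<forall>u v c. g (0, u) (0, v) c = 0) \<and>
     (\<forall>u b w. g (0, u) b (0, w) = 0) \<and>
     (\<forall>a v w. g a (0, v) (0, w) = 0)}"

definition Z2_pair ::
  "('k::field \<Rightarrow> 'a::ab_group_add \<Rightarrow> 'a) \<Rightarrow> ('k \<Rightarrow> 'v::ab_group_add \<Rightarrow> 'v)
    \<Rightarrow> ('a \<Rightarrow> 'a \<Rightarrow> 'a) \<Rightarrow> ('a \<Rightarrow> 'a \<Rightarrow> 'a \<Rightarrow> 'a)
    \<Rightarrow> ('a \<Rightarrow> 'v \<Rightarrow> 'v) \<Rightarrow> ('a \<Rightarrow> 'a \<Rightarrow> 'v \<Rightarrow> 'v) \<Rightarrow> ('a \<times> 'v) cochain2 set" where
  "Z2_pair sg sv br tr \<rho> \<mu> =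
     {c \<in> C2_pair sg sv. cobd2 (sd_bin br \<rho>) (sd_ter tr (D_op br \<rho> \<mu>) \<mu>) c = 0}"

definition B2_pair ::
  "('k::field \<Rightarrow> 'a::ab_group_add \<Rightarrow> 'a) \<Rightarrow> ('k \<Rightarrow> 'v::ab_group_add \<Rightarrow> 'v)
    \<Rightarrow> ('a \<Rightarrow> 'a \<Rightarrow> 'a) \<Rightarrow> ('a \<Rightarrow> 'a \<Rightarrow> 'a \<Rightarrow> 'a)
    \<Rightarrow> ('a \<Rightarrow> 'v \<Rightarrow> 'v) \<Rightarrow> ('a \<Rightarrow> 'a \<Rightarrow> 'v \<Rightarrow> 'v) \<Rightarrow> ('a \<times> 'v) cochain2 set" where
  "B2_pair sg sv br tr \<rho> \<mu> =
     cobd1 (sd_bin br \<rho>) (sd_ter tr (D_op br \<rho> \<mu>) \<mu>) ` C1_pair sg sv"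

definition cohomologous ::
  "('k::field \<Rightarrow> 'a::ab_group_add \<Rightarrow> 'a) \<Rightarrow> ('k \<Rightarrow> 'v::ab_group_add \<Rightarrow> 'v)
    \<Rightarrow> ('a \<Rightarrow> 'a \<Rightarrow> 'a) \<Rightarrow> ('a \<Rightarrow> 'a \<Rightarrow> 'a \<Rightarrow> 'a)
    \<Rightarrow> ('a \<Rightarrow> 'v \<Rightarrow> 'v) \<Rightarrow> ('a \<Rightarrow> 'a \<Rightarrow> 'v \<Rightarrow> 'v)
    \<Rightarrow> (('a \<times> 'v) cochain2 \<times> ('a \<times> 'v) cochain2) set" where
  "cohomologous sg sv br tr \<rho> \<mu> =
     {(c, c'). c \<in> Z2_pair sg sv br tr \<rho> \<mu> \<and> c' \<in> Z2_pair sg sv br tr \<rho> \<mu> \<and>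
               c - c' \<in> B2_pair sg sv br tr \<rho> \<mu>}"

text \<open>The quotient is represented by the set of its cosets in the space of cocycles.\<close>

definition H2_pair ::
  "('k::field \<Rightarrow> 'a::ab_group_add \<Rightarrow> 'a) \<Rightarrow> ('k \<Rightarrow> 'v::ab_group_add \<Rightarrow> 'v)
    \<Rightarrow> ('a \<Rightarrow> 'a \<Rightarrow> 'a) \<Rightarrow> ('a \<Rightarrow> 'a \<Rightarrow> 'a \<Rightarrow> 'a)
    \<Rightarrow> ('a \<Rightarrow> 'v \<Rightarrow> 'v) \<Rightarrow> ('a \<Rightarrow> 'a \<Rightarrow> 'v \<Rightarrow> 'v) \<Rightarrow> ('a \<times> 'v) cochain2 set set" where
  "H2_pair sg sv br tr \<rho> \<mu> = Z2_pair sg sv br tr \<rho> \<mu> // cohomologous sg sv br tr \<rho> \<mu>"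

end

theory Submission
  imports Defs
begin

text \<open>
  A LieYRep pair makes the semidirect product \<open>L = \<gg> \<oplus> V\<close> a Lie-Yamaguti algebra
  (\<open>lieyrep.lie_yamaguti_semidirect\<close>), and this construction is compatible with deformations and
  homomorphisms. Since \<open>D\<close> has degree at most two in \<open>\<rho>\<close> and the binary
  bracket and is linear in \<open>\<mu>\<close>, a linear deformation of the pair
  becomes a deformation \<open>(B + t B\<^sub>1, T + t T\<^sub>1 + t\<^sup>2 T\<^sub>2)\<close> of the two brackets of \<open>L\<close>, where \<open>(B\<^sub>1, T\<^sub>1)\<close>
  is the cochain under study; a homomorphism \<open>(Id + tN, Id + tS)\<close> of pairs becomes the homomorphism
  \<open>Id + tM\<close> of \<open>L\<close> with \<open>M = N \<oplus> S\<close>. It remains to argue with one Lie-Yamaguti algebra.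

  There, the axioms that express that \<open>T x y\<close> is a derivation of both brackets hold for every \<open>t\<close>, and
  both of their sides are polynomials in \<open>t\<close>. In characteristic \<open>0\<close> the coefficients of \<open>t\<close> agree,
  and this equality is the cocycle condition on \<open>(B\<^sub>1, T\<^sub>1)\<close> (\<open>linear_deformation_cocycle\<close>). In the
  same way the coefficient of \<open>t\<close> in the condition that \<open>Id + tM\<close> is a homomorphism says that
  \<open>(B\<^sub>1', T\<^sub>1') - (B\<^sub>1, T\<^sub>1)\<close> is the coboundary of \<open>M\<close> (\<open>equivalent_deformations_coboundary\<close>).

  The polynomials reach degree five and have many terms, of which only the linear one matters. They
  are never expanded: \<open>has_jet F a b\<close> says that the curve \<open>F\<close> is a polynomial with first-order
  Taylor part \<open>a + t b\<close>, and jets of composite expressions follow from product rules.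
\<close>

section \<open>Multilinear maps\<close>

lemma bilinear_map_iff:
  "bilinear_map s1 s2 s3 f \<longleftrightarrow>
     vector_space s1 \<and> vector_space s2 \<and> vector_space s3 \<and>
     (\<forall>x x' y. f (x + x') y = f x y + f x' y) \<and> (\<forall>x y y'. f x (y + y') = f x y + f x y') \<and>
     (\<forall>c x y. f (s1 c x) y = s3 c (f x y)) \<and> (\<forall>c x y. f x (s2 c y) = s3 c (f x y))"
  unfolding bilinear_map_def Vector_Spaces.linear_iff by blast

lemma trilinear_map_iff:
  "trilinear_map s1 s2 s3 s4 f \<longleftrightarrow>
     (\<forall>x. bilinear_map s2 s3 s4 (f x)) \<and> (\<forall>y z. Vector_Spaces.linear s1 s4 (\<lambda>x. f x y z))"
  unfolding trilinear_map_def bilinear_map_def by blast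

lemma bilinear_map_simps:
  assumes "bilinear_map s1 s2 s3 f"
  shows "f (x + x') y = f x y + f x' y" "f x (y + y') = f x y + f x y'"
    and "f (s1 c x) y = s3 c (f x y)" "f x (s2 c y) = s3 c (f x y)"
    and "f 0 y = 0" "f x 0 = 0"
    and "f (- x) y = - f x y" "f x (- y) = - f x y"
    and "f (x - x') y = f x y - f x' y" "f x (y - y') = f x y - f x y'"
proof -
  have lin: "Vector_Spaces.linear s2 s3 (f x)" "Vector_Spaces.linear s1 s3 (\<lambda>x. f x y)" for x y
    using assms by (auto simp: bilinear_map_def)
  interpret l: module_hom s2 s3 "f x" for x
    using lin(1) by (simp add: module_hom_iff_linear)
  interpret r: module_hom s1 s3 "\<lambda>x. f x y" for y
    using lin(2) by (simp add: module_hom_iff_linear)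
  show "f (x + x') y = f x y + f x' y" "f x (y + y') = f x y + f x y'"
    "f (s1 c x) y = s3 c (f x y)" "f x (s2 c y) = s3 c (f x y)"
    "f 0 y = 0" "f x 0 = 0" "f (- x) y = - f x y" "f x (- y) = - f x y"
    "f (x - x') y = f x y - f x' y" "f x (y - y') = f x y - f x y'"
    by (rule r.add l.add r.scale l.scale r.zero l.zero r.neg l.neg r.diff l.diff)+
qed

lemma trilinear_map_simps:
  assumes "trilinear_map s1 s2 s3 s4 f"
  shows "f (x + x') y z = f x y z + f x' y z" "f x (y + y') z = f x y z + f x y' z"
      "f x y (z + z') = f x y z + f x y z'"
    and "f (s1 c x) y z = s4 c (f x y z)" "f x (s2 c y) z = s4 c (f x y z)"
      "f x y (s3 c z) = s4 c (f x y z)"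
    and "f 0 y z = 0" "f x 0 z = 0" "f x y 0 = 0"
    and "f (- x) y z = - f x y z" "f x (- y) z = - f x y z" "f x y (- z) = - f x y z"
    and "f (x - x') y z = f x y z - f x' y z" "f x (y - y') z = f x y z - f x y' z"
      "f x y (z - z') = f x y z - f x y z'"
proof -
  have bil: "bilinear_map s2 s3 s4 (f x)" and bil': "bilinear_map s1 s3 s4 (\<lambda>x z. f x y z)" for x y
    using assms by (auto simp: trilinear_map_def bilinear_map_def)
  note l = bilinear_map_simps[OF bil] and r = bilinear_map_simps[OF bil']
  show "f (x + x') y z = f x y z + f x' y z" "f x (y + y') z = f x y z + f x y' z"
    "f x y (z + z') = f x y z + f x y z'"
    "f (s1 c x) y z = s4 c (f x y z)" "f x (s2 c y) z = s4 c (f x y z)"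
    "f x y (s3 c z) = s4 c (f x y z)" "f 0 y z = 0" "f x 0 z = 0" "f x y 0 = 0"
    "f (- x) y z = - f x y z" "f x (- y) z = - f x y z" "f x y (- z) = - f x y z"
    "f (x - x') y z = f x y z - f x' y z" "f x (y - y') z = f x y z - f x y' z"
    "f x y (z - z') = f x y z - f x y z'"
    by (rule l r)+
qed

lemma alt_bilinear_antisym:
  assumes "alt_bilinear s f"
  shows "f y x = - f x y"
proof -
  have "f (x + y) (x + y) = 0" and bil: "bilinear_map s s s f"
    and "f x x = 0" "f y y = 0"
    using assms by (auto simp: alt_bilinear_def)
  then show ?thesis
    by (simp add: bilinear_map_simps[OF bil] add_eq_0_iff)
qed

lemma alt_trilinear_antisym:
  assumes "alt_trilinear s g"
  shows "g y x z = - g x y z"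
proof -
  have "g (x + y) (x + y) z = 0" and tri: "trilinear_map s s s s g"
    and "g x x z = 0" "g y y z = 0"
    using assms by (auto simp: alt_trilinear_def)
  then show ?thesis
    by (simp add: trilinear_map_simps[OF tri] add_eq_0_iff)
qed

lemma lie_yamagutiD:
  assumes "lie_yamaguti s br tr"
  shows "bilinear_map s s s br" "trilinear_map s s s s tr"
    and "br y x = - br x y" "tr y x z = - tr x y z"
    and "br (br x y) z + br (br y z) x + br (br z x) y + tr x y z + tr y z x + tr z x y = 0"
    and "tr (br x y) z w + tr (br y z) x w + tr (br z x) y w = 0"
    and "tr x y (br z w) = br (tr x y z) w + br z (tr x y w)"
    and "tr x y (tr z w t) = tr (tr x y z) w t + tr z (tr x y w) t + tr z w (tr x y t)"
proof -
  have alt: "alt_bilinear s br" "alt_trilinear s tr"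
    using assms unfolding lie_yamaguti_def by blast+
  then show "bilinear_map s s s br" "trilinear_map s s s s tr"
    by (simp_all add: alt_bilinear_def alt_trilinear_def)
  show "br y x = - br x y" "tr y x z = - tr x y z"
    by (rule alt_bilinear_antisym[OF alt(1)] alt_trilinear_antisym[OF alt(2)])+
qed (use assms in \<open>unfold lie_yamaguti_def, blast+\<close>)

section \<open>First-order jets of polynomial curves\<close>

locale vector_space_char_0 = vector_space scale
  for scale :: "'k::field_char_0 \<Rightarrow> 'b::ab_group_add \<Rightarrow> 'b" (infixr \<open>*s\<close> 75)
begin

text \<open>
  Polynomial curves are built by Horner's scheme because each product rule below is then a plain
  induction on one factor.
\<close>

inductive has_jet :: "('k \<Rightarrow> 'b) \<Rightarrow> 'b \<Rightarrow> 'b \<Rightarrow> bool" where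
  const: "has_jet (\<lambda>t. a) a 0"
| horner: "has_jet F b c \<Longrightarrow> has_jet (\<lambda>t. a + t *s F t) a b"

text \<open>
  Substituting \<open>2t\<close> for \<open>t\<close> and subtracting \<open>2\<^sup>n\<close> times the original relation, with \<open>n\<close> the degree,
  cancels the leading coefficient and multiplies each lower coefficient \<open>c i\<close> by
  \<open>2\<^sup>i - 2\<^sup>n\<close>, which is invertible in characteristic \<open>0\<close>.
\<close>

lemma power_sum_eq_0D:
  assumes "\<And>t. (\<Sum>i\<le>n. t ^ i *s c i) = 0" and "i \<le> n"
  shows "c i = 0"
  using assms
proof (induction n arbitrary: c i)
  case 0
  then show ?case by simp
next
  case (Suc n)
  have lower: "c i = 0" if "i \<le> n" for i
  proof -
    \<comment> \<open>The coefficients after the leading term has been cancelled.\<close>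
    let ?d = "\<lambda>i. (2 ^ i - 2 ^ Suc n :: 'k) *s c i"
    have "(\<Sum>i\<le>n. t ^ i *s ?d i) = 0" for t
    proof -
      have "(\<Sum>i\<le>n. t ^ i *s ?d i) = (\<Sum>i\<le>Suc n. t ^ i *s ?d i)"
        by simp
      also have "\<dots> = (\<Sum>i\<le>Suc n. (2 * t) ^ i *s c i) - 2 ^ Suc n *s (\<Sum>i\<le>Suc n. t ^ i *s c i)"
        unfolding scale_sum_right sum_subtractf[symmetric]
        by (rule sum.cong) (simp_all add: algebra_simps power_mult_distrib del: power_Suc)
      finally show ?thesis
        by (simp only: Suc.prems(1)) simp
    qed
    from Suc.IH[OF this that] have "?d i = 0" .
    moreover have "(2::'k) ^ i \<noteq> 2 ^ Suc n"
    proof -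
      have "(2::nat) ^ i \<noteq> 2 ^ Suc n"
        using that by (subst power_inject_exp) auto
      then have "of_nat (2 ^ i) \<noteq> (of_nat (2 ^ Suc n) :: 'k)"
        by (simp only: of_nat_eq_iff not_False_eq_True)
      then show ?thesis by simp
    qed
    ultimately show "c i = 0"
      by (simp del: power_Suc)
  qed
  moreover have "c (Suc n) = 0"
    using Suc.prems(1)[of 1] lower by simp
  ultimately show ?case
    using Suc.prems(2) le_Suc_eq by auto
qed

lemma has_jet_power_sum:
  assumes "has_jet F a b"
  obtains n c where "\<And>t. F t = (\<Sum>i\<le>Suc n. t ^ i *s c i)" "c 0 = a" "c 1 = b"
proof -
  from assms have "\<exists>n c. (\<forall>t. F t = (\<Sum>i\<le>Suc n. t ^ i *s c i)) \<and> c 0 = a \<and> c 1 = b"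
  proof induction
    case (const a)
    show ?case
      by (rule exI[of _ 0], rule exI[of _ "\<lambda>i. if i = 0 then a else 0"]) simp
  next
    case (horner F b d a)
    then obtain n c where F: "\<And>t. F t = (\<Sum>i\<le>Suc n. t ^ i *s c i)" and c: "c 0 = b"
      by blast
    have "a + t *s F t = (\<Sum>i\<le>Suc (Suc n). t ^ i *s case_nat a c i)" for t
      by (simp add: F sum.atMost_Suc_shift[of _ "Suc n"] scale_sum_right del: sum.atMost_Suc)
    with c show ?case
      by (intro exI[of _ "Suc n"] exI[of _ "case_nat a c"]) simp
  qed
  with that show thesis by blast
qed

lemma has_jet_add:
  assumes "has_jet F a b" "has_jet G c d"
  shows "has_jet (\<lambda>t. F t + G t) (a + c) (b + d)"
  using assms
proof (induction arbitrary: G c d)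
  case (const a)
  from const.prems show ?case
  proof cases
    case const
    then show ?thesis using has_jet.const[of "a + c"] by simp
  next
    case (horner G' d')
    then show ?thesis using has_jet.horner[OF horner(2), of "a + c"] by (simp add: add.assoc)
  qed
next
  case (horner F b e a)
  from horner.prems show ?case
  proof cases
    case const
    then show ?thesis
      using has_jet.horner[OF horner.hyps, of "a + c"] by (simp add: ac_simps)
  next
    case (horner G' d')
    from has_jet.horner[OF horner.IH[OF horner(2)], of "a + c"]
    show ?thesis by (simp add: horner(1) scale_right_distrib ac_simps)
  qed
qed

lemma has_jet_shift: "has_jet F a b \<Longrightarrow> has_jet (\<lambda>t. t *s F t) 0 a"
  using has_jet.horner[of F a b 0] by simp

lemma has_jet_linear:
  assumes "Vector_Spaces.linear scale scale f" and "has_jet F a b"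
  shows "has_jet (\<lambda>t. f (F t)) (f a) (f b)"
proof -
  interpret f: module_hom scale scale f
    using assms(1) by (simp add: module_hom_iff_linear)
  from assms(2) show ?thesis
  proof induction
    case (const a)
    then show ?case using has_jet.const[of "f a"] by (simp add: f.zero)
  next
    case (horner F b c a)
    then show ?case using has_jet.horner[of _ "f b" _ "f a"] by (simp add: f.add f.scale)
  qed
qed

text \<open>The product rules: a jet is determined by the jets of the factors, as for derivatives.\<close>

lemma has_jet_bilinear:
  assumes bil: "bilinear_map scale scale scale f" and "has_jet F a a'" and G: "has_jet G b b'"
  shows "has_jet (\<lambda>t. f (F t) (G t)) (f a b) (f a' b + f a b')"
  using assms(2)
proof induction
  case (const a)
  have "Vector_Spaces.linear scale scale (f a)"
    using bil by (simp add: bilinear_map_def)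
  from has_jet_linear[OF this G] show ?case
    by (simp add: bilinear_map_simps[OF bil])
next
  case (horner F b c a)
  have "Vector_Spaces.linear scale scale (f a)"
    using bil by (simp add: bilinear_map_def)
  from has_jet_add[OF has_jet_linear[OF this G] has_jet_shift[OF horner.IH]] show ?case
    by (simp add: bilinear_map_simps[OF bil] add.commute)
qed

lemma has_jet_trilinear:
  assumes tri: "trilinear_map scale scale scale scale f"
    and "has_jet F a a'" and G: "has_jet G b b'" and H: "has_jet H c c'"
  shows "has_jet (\<lambda>t. f (F t) (G t) (H t)) (f a b c) (f a' b c + f a b' c + f a b c')"
  using assms(2)
proof induction
  case (const a)
  have "bilinear_map scale scale scale (f a)"
    using tri by (simp add: trilinear_map_iff)
  from has_jet_bilinear[OF this G H] show ?case
    by (simp add: trilinear_map_simps[OF tri])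
next
  case (horner F d e a)
  have "bilinear_map scale scale scale (f a)"
    using tri by (simp add: trilinear_map_iff)
  from has_jet_add[OF has_jet_bilinear[OF this G H] has_jet_shift[OF horner.IH]] show ?case
    by (simp add: trilinear_map_simps[OF tri] ac_simps)
qed

text \<open>
  Equal polynomial curves have equal coefficients of \<open>t\<close>. This is how an identity that holds for all
  \<open>t\<close> yields an identity between first-order terms.
\<close>

lemma has_jet_unique:
  assumes "has_jet F a b" "has_jet G c d" and "\<And>t. F t = G t"
  shows "b = d"
proof -
  have lin: "Vector_Spaces.linear scale scale uminus"
    using vector_space_axioms by (simp add: Vector_Spaces.linear_iff)
  have "has_jet (\<lambda>t. 0) (a + - c) (b + - d)"
    using has_jet_add[OF assms(1) has_jet_linear[OF lin assms(2)]] by (simp add: assms(3))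
  from has_jet_power_sum[OF this] obtain n e
    where "\<And>t. 0 = (\<Sum>i\<le>Suc n. t ^ i *s e i)" "e 1 = b + - d"
    by metis
  with power_sum_eq_0D[of e "Suc n" 1] show ?thesis by simp
qed

text \<open>
  The product rule for brackets that depend on \<open>t\<close> themselves: the first-order term of the bracket
  contributes one more summand.
\<close>

lemma has_jet_deform1:
  assumes "bilinear_map scale scale scale B" "bilinear_map scale scale scale B\<^sub>1"
    and "has_jet F a a'" "has_jet G b b'"
  shows "has_jet (\<lambda>t. deform1 scale B B\<^sub>1 t (F t) (G t)) (B a b) (B a' b + B a b' + B\<^sub>1 a b)"
  unfolding deform1_def
  using has_jet_add[OF has_jet_bilinear[OF assms(1,3,4)]
      has_jet_shift[OF has_jet_bilinear[OF assms(2-4)]]]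
  by simp

lemma has_jet_deform2:
  assumes "trilinear_map scale scale scale scale T" "trilinear_map scale scale scale scale T\<^sub>1"
    "trilinear_map scale scale scale scale T\<^sub>2"
    and "has_jet F a a'" "has_jet G b b'" "has_jet H c c'"
  shows "has_jet (\<lambda>t. deform2 scale T T\<^sub>1 T\<^sub>2 t (F t) (G t) (H t)) (T a b c)
           (T a' b c + T a b' c + T a b c' + T\<^sub>1 a b c)"
  unfolding deform2_def
  using has_jet_add[OF has_jet_add[OF has_jet_trilinear[OF assms(1,4-)]
        has_jet_shift[OF has_jet_trilinear[OF assms(2,4-)]]]
      has_jet_shift[OF has_jet_shift[OF has_jet_trilinear[OF assms(3-)]]]]
  by (simp add: power2_eq_square)

section \<open>Linear deformations of a Lie-Yamaguti algebra\<close>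

text \<open>
  The two components of the cocycle condition are the coefficients of \<open>t\<close> in the identities
  \<open>T x y (B z w) = B (T x y z) w + B z (T x y w)\<close> and
  \<open>T x y (T z w v) = T (T x y z) w v + T z (T x y w) v + T z w (T x y v)\<close> of the deformed brackets. The
  antisymmetry of \<open>B\<close> and \<open>T\<close> accounts for the different arrangement of arguments in \<open>cobd2\<close>.
\<close>

lemma linear_deformation_cocycle:
  assumes ly: "lie_yamaguti scale B T"
    and B\<^sub>1: "bilinear_map scale scale scale B\<^sub>1" and T\<^sub>1: "trilinear_map scale scale scale scale T\<^sub>1"
    and T\<^sub>2: "trilinear_map scale scale scale scale T\<^sub>2"
    and deformed: "\<And>t. lie_yamaguti scale (deform1 scale B B\<^sub>1 t) (deform2 scale T T\<^sub>1 T\<^sub>2 t)"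
  shows "cobd2 B T (B\<^sub>1, T\<^sub>1) = 0"
proof -
  note B = lie_yamagutiD(1)[OF ly] and T = lie_yamagutiD(2)[OF ly]
    and Ba = lie_yamagutiD(3)[OF ly] and Ta = lie_yamagutiD(4)[OF ly]
  note jB = has_jet_deform1[OF B B\<^sub>1] and jT = has_jet_deform2[OF T T\<^sub>1 T\<^sub>2] and c = has_jet.const
  note zero = bilinear_map_simps(5,6)[OF B] trilinear_map_simps(7-9)[OF T]
  let ?B = "deform1 scale B B\<^sub>1" and ?T = "deform2 scale T T\<^sub>1 T\<^sub>2"
  have I: "T x y (B\<^sub>1 z w) + T\<^sub>1 x y (B z w)
      = (B (T\<^sub>1 x y z) w + B\<^sub>1 (T x y z) w) + (B z (T\<^sub>1 x y w) + B\<^sub>1 z (T x y w))" for x y z w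
  proof -
    have "?T t x y (?B t z w) = ?B t (?T t x y z) w + ?B t z (?T t x y w)" for t
      by (rule lie_yamagutiD(7)[OF deformed])
    from has_jet_unique[OF jT[OF c[of x] c[of y] jB[OF c[of z] c[of w]]]
        has_jet_add[OF jB[OF jT[OF c[of x] c[of y] c[of z]] c[of w]]
          jB[OF c[of z] jT[OF c[of x] c[of y] c[of w]]]] this]
    show ?thesis by (simp add: zero)
  qed
  have II: "T x y (T\<^sub>1 z w v) + T\<^sub>1 x y (T z w v)
      = (T (T\<^sub>1 x y z) w v + T\<^sub>1 (T x y z) w v) + (T z (T\<^sub>1 x y w) v + T\<^sub>1 z (T x y w) v)
        + (T z w (T\<^sub>1 x y v) + T\<^sub>1 z w (T x y v))" for x y z w v
  proof -
    have "?T t x y (?T t z w v)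
        = ?T t (?T t x y z) w v + ?T t z (?T t x y w) v + ?T t z w (?T t x y v)" for t
      by (rule lie_yamagutiD(8)[OF deformed])
    from has_jet_unique[OF jT[OF c[of x] c[of y] jT[OF c[of z] c[of w] c[of v]]]
        has_jet_add[OF has_jet_add[OF jT[OF jT[OF c[of x] c[of y] c[of z]] c[of w] c[of v]]
            jT[OF c[of z] jT[OF c[of x] c[of y] c[of w]] c[of v]]]
          jT[OF c[of z] c[of w] jT[OF c[of x] c[of y] c[of v]]]] this]
    show ?thesis by (simp add: zero)
  qed
  have "cobd2 B T (B\<^sub>1, T\<^sub>1) = 0 \<longleftrightarrow>
      (\<forall>x y z w. - (B z (T\<^sub>1 x y w) - B w (T\<^sub>1 x y z) - T\<^sub>1 x y (B z w))
        + T x y (B\<^sub>1 z w) - B\<^sub>1 (T x y z) w - B\<^sub>1 z (T x y w) = 0) \<and>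
      (\<forall>x y z w v. - (T (T\<^sub>1 x y z) w v - T (T\<^sub>1 x y w) z v) + T x y (T\<^sub>1 z w v) - T z w (T\<^sub>1 x y v)
        - T\<^sub>1 (T x y z) w v - T\<^sub>1 z (T x y w) v - T\<^sub>1 z w (T x y v) + T\<^sub>1 x y (T z w v) = 0)"
    by (simp add: zero_prod_def fun_eq_iff)
  moreover have "- (B z (T\<^sub>1 x y w) - B w (T\<^sub>1 x y z) - T\<^sub>1 x y (B z w))
      + T x y (B\<^sub>1 z w) - B\<^sub>1 (T x y z) w - B\<^sub>1 z (T x y w) = 0" for x y z w
    unfolding Ba[of w "T\<^sub>1 x y z"] using I[of x y z w] by (simp add: algebra_simps)
  moreover have "- (T (T\<^sub>1 x y z) w v - T (T\<^sub>1 x y w) z v) + T x y (T\<^sub>1 z w v) - T z w (T\<^sub>1 x y v)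
      - T\<^sub>1 (T x y z) w v - T\<^sub>1 z (T x y w) v - T\<^sub>1 z w (T x y v) + T\<^sub>1 x y (T z w v) = 0" for x y z w v
    unfolding Ta[of "T\<^sub>1 x y w" z v] using II[of x y z w v] by (simp add: algebra_simps)
  ultimately show ?thesis
    by blast
qed

text \<open>
  To first order, \<open>B\<^sub>1' x y + M (B x y) = B (M x) y + B x (M y) + B\<^sub>1 x y\<close>, and likewise for \<open>T\<close>; up to
  antisymmetry this is the definition of the coboundary of \<open>M\<close>.
\<close>

lemma equivalent_deformations_coboundary:
  assumes ly: "lie_yamaguti scale B T"
    and B\<^sub>1: "bilinear_map scale scale scale B\<^sub>1" "bilinear_map scale scale scale B\<^sub>1'"
    and T\<^sub>1: "trilinear_map scale scale scale scale T\<^sub>1" "trilinear_map scale scale scale scale T\<^sub>1'"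
    and T\<^sub>2: "trilinear_map scale scale scale scale T\<^sub>2" "trilinear_map scale scale scale scale T\<^sub>2'"
    and M: "Vector_Spaces.linear scale scale M"
    and hom_B: "\<And>t x y. deform1 scale B B\<^sub>1' t x y + t *s M (deform1 scale B B\<^sub>1' t x y)
        = deform1 scale B B\<^sub>1 t (x + t *s M x) (y + t *s M y)"
    and hom_T: "\<And>t x y z. deform2 scale T T\<^sub>1' T\<^sub>2' t x y z + t *s M (deform2 scale T T\<^sub>1' T\<^sub>2' t x y z)
        = deform2 scale T T\<^sub>1 T\<^sub>2 t (x + t *s M x) (y + t *s M y) (z + t *s M z)"
  shows "(B\<^sub>1', T\<^sub>1') - (B\<^sub>1, T\<^sub>1) = cobd1 B T M"
proof -
  note B = lie_yamagutiD(1)[OF ly] and T = lie_yamagutiD(2)[OF ly]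
    and Ba = lie_yamagutiD(3)[OF ly] and Ta = lie_yamagutiD(4)[OF ly]
  note zero = bilinear_map_simps(5,6)[OF B] trilinear_map_simps(7-9)[OF T]
  have c: "has_jet (\<lambda>t. x) x 0" and a: "has_jet (\<lambda>t. x + t *s M x) x (M x)" for x
    using has_jet.const has_jet.horner[OF has_jet.const] by auto
  have b: "has_jet (\<lambda>t. F t + t *s M (F t)) p (q + M p)" if "has_jet F p q" for F p q
    using has_jet_add[OF that has_jet_shift[OF has_jet_linear[OF M that]]] by simp
  have "B\<^sub>1' x y + M (B x y) = B (M x) y + B x (M y) + B\<^sub>1 x y" for x y
    using has_jet_unique[OF b[OF has_jet_deform1[OF B B\<^sub>1(2) c[of x] c[of y]]]
        has_jet_deform1[OF B B\<^sub>1(1) a[of x] a[of y]] hom_B]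
    by (simp add: zero)
  moreover have "T\<^sub>1' x y z + M (T x y z) = T (M x) y z + T x (M y) z + T x y (M z) + T\<^sub>1 x y z" for x y z
    using has_jet_unique[OF b[OF has_jet_deform2[OF T T\<^sub>1(2) T\<^sub>2(2) c[of x] c[of y] c[of z]]]
        has_jet_deform2[OF T T\<^sub>1(1) T\<^sub>2(1) a[of x] a[of y] a[of z]] hom_T]
    by (simp add: zero)
  ultimately have B\<^sub>1': "B\<^sub>1' x y = B (M x) y + B x (M y) + B\<^sub>1 x y - M (B x y)"
    and T\<^sub>1': "T\<^sub>1' x y z = T (M x) y z + T x (M y) z + T x y (M z) + T\<^sub>1 x y z - M (T x y z)" for x y z
    by (metis add_diff_cancel_right')+
  show ?thesis
    unfolding cobd1_def minus_prod_def
    by (simp add: fun_eq_iff B\<^sub>1' T\<^sub>1' Ba[of _ "M _"] Ta[of "M _"])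
qed

end

section \<open>The semidirect product of a LieYRep pair\<close>

lemma alt_bilinear_sd_bin:
  assumes f: "alt_bilinear sg f" and r: "bilinear_map sg sv sv r"
  shows "alt_bilinear (module_prod.scale sg sv) (sd_bin f r)"
proof -
  have "vector_space sg" "vector_space sv" and f': "bilinear_map sg sg sg f"
    using f r by (simp_all add: bilinear_map_iff alt_bilinear_def)
  then interpret vector_space_prod sg sv
    by (simp add: vector_space_prod_def vector_space_pair_def)
  show ?thesis
    unfolding alt_bilinear_def bilinear_map_iff
    using f p.vector_space_axioms
    by (auto simp: alt_bilinear_def scale_prod bilinear_map_simps[OF f'] bilinear_map_simps[OF r]
        zero_prod_def algebra_simps)
qed

lemma alt_trilinear_sd_ter:
  assumes g: "alt_trilinear sg g" and d: "trilinear_map sg sg sv sv d" "\<And>x v. d x x v = 0"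
    and m: "trilinear_map sg sg sv sv m"
  shows "alt_trilinear (module_prod.scale sg sv) (sd_ter g d m)"
proof -
  have "vector_space sg" "vector_space sv" and g': "trilinear_map sg sg sg sg g"
    using g m by (simp_all add: trilinear_map_iff bilinear_map_iff alt_trilinear_def)
  then interpret vector_space_prod sg sv
    by (simp add: vector_space_prod_def vector_space_pair_def)
  show ?thesis
    unfolding alt_trilinear_def trilinear_map_def Vector_Spaces.linear_iff
    using g p.vector_space_axioms
    by (auto simp: alt_trilinear_def scale_prod trilinear_map_simps[OF g'] trilinear_map_simps[OF d(1)]
        d(2) trilinear_map_simps[OF m] zero_prod_def algebra_simps)
qed

locale lieyrep =
  fixes sg :: "'k::field \<Rightarrow> 'a::ab_group_add \<Rightarrow> 'a" and sv :: "'k \<Rightarrow> 'v::ab_group_add \<Rightarrow> 'v"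
    and br :: "'a \<Rightarrow> 'a \<Rightarrow> 'a" and tr :: "'a \<Rightarrow> 'a \<Rightarrow> 'a \<Rightarrow> 'a"
    and \<rho> :: "'a \<Rightarrow> 'v \<Rightarrow> 'v" and \<mu> :: "'a \<Rightarrow> 'a \<Rightarrow> 'v \<Rightarrow> 'v"
  assumes pair: "lieyrep_pair sg sv br tr \<rho> \<mu>"
begin

abbreviation D :: "'a \<Rightarrow> 'a \<Rightarrow> 'v \<Rightarrow> 'v" where
  "D \<equiv> D_op br \<rho> \<mu>"

lemma lie_yamaguti: "lie_yamaguti sg br tr" and rep: "ly_representation sg sv br tr \<rho> \<mu>"
  using pair by (simp_all add: lieyrep_pair_def)

lemma multilinear:
  "bilinear_map sg sg sg br" "trilinear_map sg sg sg sg tr"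
  "bilinear_map sg sv sv \<rho>" "trilinear_map sg sg sv sv \<mu>"
  using lie_yamagutiD(1,2)[OF lie_yamaguti] rep by (auto simp: ly_representation_def)

lemmas multilinear_simps =
  bilinear_map_simps[OF multilinear(1)] trilinear_map_simps[OF multilinear(2)]
  bilinear_map_simps[OF multilinear(3)] trilinear_map_simps[OF multilinear(4)]

lemma rep_identities:
  shows mu_br_left: "\<mu> (br x y) z v = \<mu> x z (\<rho> y v) - \<mu> y z (\<rho> x v)"
    and mu_br_right: "\<mu> x (br y z) v = \<rho> y (\<mu> x z v) - \<rho> z (\<mu> x y v)"
    and rho_tr: "\<rho> (tr x y z) v = D x y (\<rho> z v) - \<rho> z (D x y v)"
    and mu_tr: "\<mu> x (tr y z w) v = \<mu> z w (\<mu> x y v) - \<mu> y w (\<mu> x z v) + D y z (\<mu> x w v)"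
    and mu_derivation: "\<mu> (tr x y z) w v + \<mu> z (tr x y w) v = D x y (\<mu> z w v) - \<mu> z w (D x y v)"
proof -
  have 1: "\<mu> (br x y) z - (\<mu> x z \<circ> \<rho> y) + (\<mu> y z \<circ> \<rho> x) = 0"
    and 2: "\<mu> x (br y z) - (\<rho> y \<circ> \<mu> x z) + (\<rho> z \<circ> \<mu> x y) = 0"
    and 3: "\<rho> (tr x y z) = commutator (D x y) (\<rho> z)"
    and 4: "(\<mu> z w \<circ> \<mu> x y) - (\<mu> y w \<circ> \<mu> x z) - \<mu> x (tr y z w) + (D y z \<circ> \<mu> x w) = 0"
    and 5: "\<mu> (tr x y z) w + \<mu> z (tr x y w) = commutator (D x y) (\<mu> z w)"
    using rep unfolding ly_representation_def Let_def by blast+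
  show "\<mu> (br x y) z v = \<mu> x z (\<rho> y v) - \<mu> y z (\<rho> x v)"
    using fun_cong[OF 1, of v] by (simp add: algebra_simps)
  show "\<mu> x (br y z) v = \<rho> y (\<mu> x z v) - \<rho> z (\<mu> x y v)"
    using fun_cong[OF 2, of v] by (simp add: algebra_simps)
  show "\<rho> (tr x y z) v = D x y (\<rho> z v) - \<rho> z (D x y v)"
    using fun_cong[OF 3, of v] by (simp add: commutator_def)
  show "\<mu> x (tr y z w) v = \<mu> z w (\<mu> x y v) - \<mu> y w (\<mu> x z v) + D y z (\<mu> x w v)"
    using fun_cong[OF 4, of v] by (simp add: algebra_simps)
  show "\<mu> (tr x y z) w v + \<mu> z (tr x y w) v = D x y (\<mu> z w v) - \<mu> z w (D x y v)"
    using fun_cong[OF 5, of v] by (simp add: commutator_def)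
qed

lemma D_apply: "D x y v = \<mu> y x v - \<mu> x y v + (\<rho> x (\<rho> y v) - \<rho> y (\<rho> x v)) - \<rho> (br x y) v"
  by (simp add: D_op_def commutator_def)

lemma trilinear_D: "trilinear_map sg sg sv sv D"
proof -
  have "vector_space sg" "vector_space sv"
    using multilinear(3) by (simp_all add: bilinear_map_iff)
  then interpret g: vector_space sg + v: vector_space sv .
  show ?thesis
    unfolding trilinear_map_def Vector_Spaces.linear_iff
    using g.vector_space_axioms v.vector_space_axioms
    by (auto simp: D_apply multilinear_simps algebra_simps)
qed

lemma br_self: "br x x = 0" and tr_self: "tr x x z = 0"
  using lie_yamaguti by (simp_all add: lie_yamaguti_def alt_bilinear_def alt_trilinear_def)

lemma D_self: "D x x v = 0"
  by (simp add: D_apply br_self multilinear_simps)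

lemmas D_simps = trilinear_map_simps[OF trilinear_D]

text \<open>
  The operators \<open>D\<close> represent the inner derivations \<open>tr x y\<close>. By its definition \<open>D z w\<close> is an expression
  in \<open>\<rho>\<close>, \<open>\<mu>\<close> and the bracket, and commutation with \<open>D x y\<close> acts on each of these ingredients as
  \<open>tr x y\<close> acts on their arguments.
\<close>

lemma D_commutator: "D x y (D z w v) - D z w (D x y v) = D (tr x y z) w v + D z (tr x y w) v"
proof -
  have der_mu: "D x y (\<mu> a b v) = \<mu> a b (D x y v) + \<mu> (tr x y a) b v + \<mu> a (tr x y b) v" for a b v
    using mu_derivation[of x y a b v] by (simp add: algebra_simps)
  have der_rho: "D x y (\<rho> a v) = \<rho> a (D x y v) + \<rho> (tr x y a) v" for a v
    using rho_tr[of x y a v] by (simp add: algebra_simps)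
  have "D x y (D z w v) = D x y (\<mu> w z v) - D x y (\<mu> z w v)
      + (D x y (\<rho> z (\<rho> w v)) - D x y (\<rho> w (\<rho> z v))) - D x y (\<rho> (br z w) v)"
    by (simp add: D_apply[of z w v] D_simps)
  then show ?thesis
    by (simp add: der_mu der_rho D_apply[of z w "D x y v"] D_apply[of "tr x y z"] D_apply[of z "tr x y w"]
        lie_yamagutiD(7)[OF lie_yamaguti] multilinear_simps algebra_simps)
qed

text \<open>
  The cyclic sum of \<open>\<rho> [[x, y], z]\<close> is traded for that of \<open>- \<rho> (tr x y z)\<close>, that is, of the commutators of
  \<open>D\<close> with \<open>\<rho>\<close>; what remains cancels by the Jacobi identity for commutators of operators and
  the two rules for \<open>\<mu>\<close> at a bracket.
\<close>

lemma D_cyclic: "D (br x y) z v + D (br y z) x v + D (br z x) y v = 0"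
proof -
  have jac: "br (br x y) z + br (br y z) x + br (br z x) y = - (tr x y z + tr y z x + tr z x y)"
    using lie_yamagutiD(5)[OF lie_yamaguti, of x y z] by (simp add: algebra_simps eq_neg_iff_add_eq_0)
  have "\<rho> (br (br x y) z) v + \<rho> (br (br y z) x) v + \<rho> (br (br z x) y) v
      = - (\<rho> (tr x y z) v + \<rho> (tr y z x) v + \<rho> (tr z x y) v)"
    using arg_cong[OF jac, of "\<lambda>a. \<rho> a v"] by (simp add: multilinear_simps)
  then have rho_jac: "\<rho> (br (br x y) z) v = - (\<rho> (tr x y z) v + \<rho> (tr y z x) v + \<rho> (tr z x y) v)
      - \<rho> (br (br y z) x) v - \<rho> (br (br z x) y) v"
    by (simp add: algebra_simps)
  show ?thesis
    by (simp add: D_apply rho_jac rho_tr mu_br_left mu_br_right multilinear_simps algebra_simps)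
qed

text \<open>
  Each axiom splits according to which argument lies in \<open>V\<close>. The part in \<open>\<gg>\<close> is the same axiom of
  \<open>\<gg>\<close>, and each part linear in \<open>V\<close> is one of the identities of a representation or a consequence of
  them: the definition of \<open>D\<close> for the first axiom, \<open>D_cyclic\<close> for the second, \<open>D_commutator\<close> for the
  last.
\<close>

theorem lie_yamaguti_semidirect:
  "lie_yamaguti (module_prod.scale sg sv) (sd_bin br \<rho>) (sd_ter tr D \<mu>)"
proof -
  have vs: "vector_space sg" "vector_space sv"
    using multilinear(3) by (simp_all add: bilinear_map_iff)
  then interpret vector_space_prod sg sv
    by (simp add: vector_space_prod_def vector_space_pair_def)
  have "alt_bilinear scale (sd_bin br \<rho>)"
    using lie_yamaguti multilinear(3) by (intro alt_bilinear_sd_bin) (simp_all add: lie_yamaguti_def)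
  moreover have "alt_trilinear scale (sd_ter tr D \<mu>)"
    using lie_yamaguti multilinear(4) trilinear_D
    by (intro alt_trilinear_sd_ter) (simp_all add: lie_yamaguti_def D_self)
  moreover have "sd_bin br \<rho> (sd_bin br \<rho> a b) c + sd_bin br \<rho> (sd_bin br \<rho> b c) a + sd_bin br \<rho> (sd_bin br \<rho> c a) b
      + sd_ter tr D \<mu> a b c + sd_ter tr D \<mu> b c a + sd_ter tr D \<mu> c a b = 0" for a b c
    using lie_yamagutiD(5)[OF lie_yamaguti, of "fst a" "fst b" "fst c"]
    by (cases a; cases b; cases c) (simp add: D_apply multilinear_simps zero_prod_def)
  moreover have "sd_ter tr D \<mu> (sd_bin br \<rho> a b) c d + sd_ter tr D \<mu> (sd_bin br \<rho> b c) a d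
      + sd_ter tr D \<mu> (sd_bin br \<rho> c a) b d = 0" for a b c d
    using lie_yamagutiD(6)[OF lie_yamaguti, of "fst a" "fst b" "fst c" "fst d"]
      D_cyclic[of "fst a" "fst b" "fst c" "snd d"]
    by (cases a; cases b; cases c; cases d)
      (simp add: mu_br_left multilinear_simps zero_prod_def algebra_simps)
  moreover have "sd_ter tr D \<mu> a b (sd_bin br \<rho> c d)
      = sd_bin br \<rho> (sd_ter tr D \<mu> a b c) d + sd_bin br \<rho> c (sd_ter tr D \<mu> a b d)" for a b c d
    by (cases a; cases b; cases c; cases d)
      (simp add: lie_yamagutiD(7)[OF lie_yamaguti] rho_tr mu_br_right multilinear_simps D_simps algebra_simps)
  moreover have "sd_ter tr D \<mu> a b (sd_ter tr D \<mu> c d e)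
      = sd_ter tr D \<mu> (sd_ter tr D \<mu> a b c) d e + sd_ter tr D \<mu> c (sd_ter tr D \<mu> a b d) e
        + sd_ter tr D \<mu> c d (sd_ter tr D \<mu> a b e)" for a b c d e
  proof -
    \<comment> \<open>The variables are named because, as unrestricted rewrite rules, \<open>mu_derivation\<close> and \<open>mu_tr\<close>
      would undo each other.\<close>
    obtain x1 u1 x2 u2 x3 u3 x4 u4 x5 u5
      where abcde: "a = (x1, u1)" "b = (x2, u2)" "c = (x3, u3)" "d = (x4, u4)" "e = (x5, u5)"
      by (metis prod.exhaust)
    have comm: "D x1 x2 (D x3 x4 u5) = D x3 x4 (D x1 x2 u5) + D (tr x1 x2 x3) x4 u5 + D x3 (tr x1 x2 x4) u5"
      using D_commutator[of x1 x2 x3 x4 u5] by (simp add: algebra_simps)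
    have der: "D x1 x2 (\<mu> x4 x5 u3)
        = \<mu> x4 x5 (D x1 x2 u3) + \<mu> (tr x1 x2 x4) x5 u3 + \<mu> x4 (tr x1 x2 x5) u3"
      "D x1 x2 (\<mu> x3 x5 u4)
        = \<mu> x3 x5 (D x1 x2 u4) + \<mu> (tr x1 x2 x3) x5 u4 + \<mu> x3 (tr x1 x2 x5) u4"
      using mu_derivation[of x1 x2 x4 x5 u3] mu_derivation[of x1 x2 x3 x5 u4]
      by (simp_all add: algebra_simps)
    show ?thesis
      unfolding abcde
      by (simp add: comm der mu_tr[of x1 x3] mu_tr[of x2 x3] lie_yamagutiD(8)[OF lie_yamaguti, of x1 x2 x3 x4 x5]
          multilinear_simps D_simps algebra_simps)
  qed
  ultimately show ?thesis
    unfolding lie_yamaguti_def by blast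
qed

end

text \<open>Homomorphisms of pairs intertwine \<open>D\<close> as well, because \<open>D\<close> is built from \<open>\<rho>\<close>, \<open>\<mu>\<close> and the bracket.\<close>

lemma lieyrep_hom_semidirect:
  assumes hom: "lieyrep_hom sg sv br tr \<rho> \<mu> sh sw br' tr' \<rho>' \<mu>' \<alpha> \<beta>"
  shows "map_prod \<alpha> \<beta> (sd_bin br \<rho> a b) = sd_bin br' \<rho>' (map_prod \<alpha> \<beta> a) (map_prod \<alpha> \<beta> b)"
    and "map_prod \<alpha> \<beta> (sd_ter tr (D_op br \<rho> \<mu>) \<mu> a b c)
      = sd_ter tr' (D_op br' \<rho>' \<mu>') \<mu>' (map_prod \<alpha> \<beta> a) (map_prod \<alpha> \<beta> b) (map_prod \<alpha> \<beta> c)"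
proof -
  have \<alpha>: "\<alpha> (br x y) = br' (\<alpha> x) (\<alpha> y)" "\<alpha> (tr x y z) = tr' (\<alpha> x) (\<alpha> y) (\<alpha> z)"
    and \<beta>: "\<beta> (\<rho> x v) = \<rho>' (\<alpha> x) (\<beta> v)" "\<beta> (\<mu> x y v) = \<mu>' (\<alpha> x) (\<alpha> y) (\<beta> v)" for x y z v
    using hom unfolding lieyrep_hom_def by blast+
  interpret \<beta>: module_hom sv sw \<beta>
    using hom by (simp add: lieyrep_hom_def module_hom_iff_linear)
  have D: "\<beta> (D_op br \<rho> \<mu> x y v) = D_op br' \<rho>' \<mu>' (\<alpha> x) (\<alpha> y) (\<beta> v)" for x y v
    by (simp add: D_op_def commutator_def \<beta>.add \<beta>.diff \<alpha> \<beta>)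
  show "map_prod \<alpha> \<beta> (sd_bin br \<rho> a b) = sd_bin br' \<rho>' (map_prod \<alpha> \<beta> a) (map_prod \<alpha> \<beta> b)"
    by (cases a; cases b) (simp add: \<alpha> \<beta> \<beta>.diff)
  show "map_prod \<alpha> \<beta> (sd_ter tr (D_op br \<rho> \<mu>) \<mu> a b c)
      = sd_ter tr' (D_op br' \<rho>' \<mu>') \<mu>' (map_prod \<alpha> \<beta> a) (map_prod \<alpha> \<beta> b) (map_prod \<alpha> \<beta> c)"
    by (cases a; cases b; cases c) (simp add: \<alpha> \<beta> D \<beta>.add \<beta>.diff)
qed

section \<open>Linear deformations of a LieYRep pair\<close>

context lieyrep
begin

lemma D_op1_apply:
  "D_op1 br \<rho> \<phi> \<sigma> \<omega>\<^sub>1 x y v = \<omega>\<^sub>1 y x v - \<omega>\<^sub>1 x y v + (\<rho> x (\<sigma> y v) - \<sigma> y (\<rho> x v))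
     + (\<sigma> x (\<rho> y v) - \<rho> y (\<sigma> x v)) - \<sigma> (br x y) v - \<rho> (\<phi> x y) v"
  by (simp add: D_op1_def commutator_def)

text \<open>
  The deformed \<open>D\<close> has degree two in \<open>t\<close>, and its leading coefficient is the operator \<open>D\<close> formed from
  the leading coefficients \<open>\<phi>\<close>, \<open>\<sigma>\<close>, \<open>\<omega>\<^sub>2\<close>.
\<close>

lemma D_op_deform:
  assumes \<sigma>: "bilinear_map sg sv sv \<sigma>"
  shows "D_op (deform1 sg br \<phi> t) (deform1 sv \<rho> \<sigma> t) (deform2 sv \<mu> \<omega>\<^sub>1 \<omega>\<^sub>2 t)
    = deform2 sv D (D_op1 br \<rho> \<phi> \<sigma> \<omega>\<^sub>1) (D_op \<phi> \<sigma> \<omega>\<^sub>2) t"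
proof -
  have "vector_space sv"
    using \<sigma> by (simp add: bilinear_map_iff)
  then interpret vector_space sv .
  show ?thesis
    by (simp add: fun_eq_iff deform1_def deform2_def D_op_def D_op1_def commutator_def
        bilinear_map_simps[OF \<sigma>] multilinear_simps power2_eq_square algebra_simps)
qed

lemma sd_bin_deform:
  assumes \<sigma>: "bilinear_map sg sv sv \<sigma>"
  shows "sd_bin (deform1 sg br \<phi> t) (deform1 sv \<rho> \<sigma> t)
    = deform1 (module_prod.scale sg sv) (sd_bin br \<rho>) (sd_bin \<phi> \<sigma>) t"
proof -
  have "vector_space sg" "vector_space sv"
    using \<sigma> by (simp_all add: bilinear_map_iff)
  then interpret vector_space_prod sg sv
    by (simp add: vector_space_prod_def vector_space_pair_def)
  show ?thesis
    by (auto simp: fun_eq_iff deform1_def scale_prod algebra_simps)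
qed

lemma sd_ter_deform:
  assumes \<sigma>: "bilinear_map sg sv sv \<sigma>"
  shows "sd_ter (deform2 sg tr \<phi>\<^sub>1 \<phi>\<^sub>2 t)
      (D_op (deform1 sg br \<phi> t) (deform1 sv \<rho> \<sigma> t) (deform2 sv \<mu> \<omega>\<^sub>1 \<omega>\<^sub>2 t)) (deform2 sv \<mu> \<omega>\<^sub>1 \<omega>\<^sub>2 t)
    = deform2 (module_prod.scale sg sv) (sd_ter tr D \<mu>)
        (sd_ter \<phi>\<^sub>1 (D_op1 br \<rho> \<phi> \<sigma> \<omega>\<^sub>1) \<omega>\<^sub>1) (sd_ter \<phi>\<^sub>2 (D_op \<phi> \<sigma> \<omega>\<^sub>2) \<omega>\<^sub>2) t"
proof -
  have "vector_space sg" "vector_space sv"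
    using \<sigma> by (simp_all add: bilinear_map_iff)
  then interpret vector_space_prod sg sv
    by (simp add: vector_space_prod_def vector_space_pair_def)
  show ?thesis
    unfolding D_op_deform[OF \<sigma>]
    by (auto simp: fun_eq_iff deform2_def scale_prod algebra_simps)
qed

end

locale lieyrep_deformation = lieyrep sg sv br tr \<rho> \<mu>
  for sg :: "'k::field_char_0 \<Rightarrow> 'a::ab_group_add \<Rightarrow> 'a" and sv :: "'k \<Rightarrow> 'v::ab_group_add \<Rightarrow> 'v"
    and br tr \<rho> \<mu> +
  fixes \<phi> \<phi>\<^sub>1 \<phi>\<^sub>2 \<sigma> \<omega>\<^sub>1 \<omega>\<^sub>2
  assumes gen: "generates_linear_deformation sg sv br tr \<rho> \<mu> \<phi> \<phi>\<^sub>1 \<phi>\<^sub>2 \<sigma> \<omega>\<^sub>1 \<omega>\<^sub>2"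
begin

abbreviation scaleL :: "'k \<Rightarrow> 'a \<times> 'v \<Rightarrow> 'a \<times> 'v" where "scaleL \<equiv> module_prod.scale sg sv"

text \<open>The coefficients of \<open>t\<close> and \<open>t\<^sup>2\<close> in the ternary bracket of the deformed semidirect product.\<close>

abbreviation "T\<^sub>1 \<equiv> sd_ter \<phi>\<^sub>1 (D_op1 br \<rho> \<phi> \<sigma> \<omega>\<^sub>1) \<omega>\<^sub>1"
abbreviation "T\<^sub>2 \<equiv> sd_ter \<phi>\<^sub>2 (D_op \<phi> \<sigma> \<omega>\<^sub>2) \<omega>\<^sub>2"

lemma generators:
  "alt_bilinear sg \<phi>" "alt_trilinear sg \<phi>\<^sub>1" "alt_trilinear sg \<phi>\<^sub>2"
  "bilinear_map sg sv sv \<sigma>" "trilinear_map sg sg sv sv \<omega>\<^sub>1" "trilinear_map sg sg sv sv \<omega>\<^sub>2"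
  using gen by (simp_all add: generates_linear_deformation_def)

lemma trilinear_D_op_coeffs:
  "trilinear_map sg sg sv sv (D_op1 br \<rho> \<phi> \<sigma> \<omega>\<^sub>1)" "trilinear_map sg sg sv sv (D_op \<phi> \<sigma> \<omega>\<^sub>2)"
proof -
  have "vector_space sg" "vector_space sv" and \<phi>: "bilinear_map sg sg sg \<phi>"
    using multilinear(3) generators(1) by (simp_all add: bilinear_map_iff alt_bilinear_def)
  then interpret g: vector_space sg + v: vector_space sv by simp_all
  note [simp] = bilinear_map_simps[OF \<phi>] bilinear_map_simps[OF generators(4)]
    trilinear_map_simps[OF generators(5)] trilinear_map_simps[OF generators(6)] multilinear_simps
  show "trilinear_map sg sg sv sv (D_op1 br \<rho> \<phi> \<sigma> \<omega>\<^sub>1)" "trilinear_map sg sg sv sv (D_op \<phi> \<sigma> \<omega>\<^sub>2)"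
    unfolding trilinear_map_def Vector_Spaces.linear_iff
    using g.vector_space_axioms v.vector_space_axioms
    by (auto simp: D_op1_apply D_op_def commutator_def algebra_simps)
qed

lemma alt_cochains:
  "alt_bilinear scaleL (sd_bin \<phi> \<sigma>)" "alt_trilinear scaleL T\<^sub>1" "alt_trilinear scaleL T\<^sub>2"
proof -
  have "\<phi> x x = 0" for x
    using generators(1) by (simp add: alt_bilinear_def)
  then have D: "D_op1 br \<rho> \<phi> \<sigma> \<omega>\<^sub>1 x x v = 0" "D_op \<phi> \<sigma> \<omega>\<^sub>2 x x v = 0" for x v
    by (simp_all add: D_op1_apply D_op_def commutator_def br_self multilinear_simps
        bilinear_map_simps[OF generators(4)])
  show "alt_bilinear scaleL (sd_bin \<phi> \<sigma>)" "alt_trilinear scaleL T\<^sub>1" "alt_trilinear scaleL T\<^sub>2"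
    by (intro alt_bilinear_sd_bin alt_trilinear_sd_ter generators trilinear_D_op_coeffs D)+
qed

lemma multilinear_cochains:
  "bilinear_map scaleL scaleL scaleL (sd_bin \<phi> \<sigma>)" "trilinear_map scaleL scaleL scaleL scaleL T\<^sub>1"
  "trilinear_map scaleL scaleL scaleL scaleL T\<^sub>2"
  using alt_cochains by (simp_all add: alt_bilinear_def alt_trilinear_def)

text \<open>
  Forming the semidirect product commutes with deforming, so that the semidirect product of the
  deformed pair is a deformation of the semidirect product.
\<close>

lemma lie_yamaguti_deformed:
  "lie_yamaguti scaleL (deform1 scaleL (sd_bin br \<rho>) (sd_bin \<phi> \<sigma>) t)
     (deform2 scaleL (sd_ter tr D \<mu>) T\<^sub>1 T\<^sub>2 t)"
proof -
  interpret t: lieyrep sg sv "deform1 sg br \<phi> t" "deform2 sg tr \<phi>\<^sub>1 \<phi>\<^sub>2 t"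
    "deform1 sv \<rho> \<sigma> t" "deform2 sv \<mu> \<omega>\<^sub>1 \<omega>\<^sub>2 t"
    using gen by unfold_locales (simp add: generates_linear_deformation_def)
  from t.lie_yamaguti_semidirect show ?thesis
    unfolding sd_ter_deform[OF generators(4)] sd_bin_deform[OF generators(4)] .
qed

sublocale L: vector_space_char_0 scaleL
  using multilinear_cochains(1) by (simp add: vector_space_char_0_def bilinear_map_iff)

theorem cocycle: "(sd_bin \<phi> \<sigma>, T\<^sub>1) \<in> Z2_pair sg sv br tr \<rho> \<mu>"
proof -
  have \<phi>: "bilinear_map sg sg sg \<phi>" and \<phi>\<^sub>1: "trilinear_map sg sg sg sg \<phi>\<^sub>1"
    using generators(1,2) by (simp_all add: alt_bilinear_def alt_trilinear_def)
  have "(sd_bin \<phi> \<sigma>, T\<^sub>1) \<in> C2_pair sg sv"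
    using alt_cochains(1,2)
    by (simp add: C2_pair_def split_paired_all zero_prod_def bilinear_map_simps[OF \<phi>]
        bilinear_map_simps[OF generators(4)] trilinear_map_simps[OF \<phi>\<^sub>1]
        trilinear_map_simps[OF trilinear_D_op_coeffs(1)] trilinear_map_simps[OF generators(5)])
  with L.linear_deformation_cocycle[OF lie_yamaguti_semidirect multilinear_cochains lie_yamaguti_deformed]
  show ?thesis
    by (simp add: Z2_pair_def)
qed

end

theorem theorem3p7:
  fixes sg :: "'k::field_char_0 \<Rightarrow> 'a::ab_group_add \<Rightarrow> 'a"
    and sv :: "'k \<Rightarrow> 'v::ab_group_add \<Rightarrow> 'v"
    and Bg :: "'a set" and Bv :: "'v set"
    and br \<phi> \<phi>' :: "'a \<Rightarrow> 'a \<Rightarrow> 'a"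
    and tr \<phi>\<^sub>1 \<phi>\<^sub>2 \<phi>\<^sub>1' \<phi>\<^sub>2' :: "'a \<Rightarrow> 'a \<Rightarrow> 'a \<Rightarrow> 'a"
    and \<rho> \<sigma> \<sigma>' :: "'a \<Rightarrow> 'v \<Rightarrow> 'v"
    and \<mu> \<omega>\<^sub>1 \<omega>\<^sub>2 \<omega>\<^sub>1' \<omega>\<^sub>2' :: "'a \<Rightarrow> 'a \<Rightarrow> 'v \<Rightarrow> 'v"
  assumes "finite_dimensional_vector_space sg Bg"
    and "finite_dimensional_vector_space sv Bv"
    and "lie_yamaguti sg br tr"
    and "ly_representation sg sv br tr \<rho> \<mu>"
    and "generates_linear_deformation sg sv br tr \<rho> \<mu> \<phi> \<phi>\<^sub>1 \<phi>\<^sub>2 \<sigma> \<omega>\<^sub>1 \<omega>\<^sub>2"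
    and "generates_linear_deformation sg sv br tr \<rho> \<mu> \<phi>' \<phi>\<^sub>1' \<phi>\<^sub>2' \<sigma>' \<omega>\<^sub>1' \<omega>\<^sub>2'"
    and "equivalent_deformations sg sv br tr \<rho> \<mu> \<phi> \<phi>\<^sub>1 \<phi>\<^sub>2 \<sigma> \<omega>\<^sub>1 \<omega>\<^sub>2 \<phi>' \<phi>\<^sub>1' \<phi>\<^sub>2' \<sigma>' \<omega>\<^sub>1' \<omega>\<^sub>2'"
  shows "\<exists>h \<in> H2_pair sg sv br tr \<rho> \<mu>.
           (sd_bin \<phi> \<sigma>, sd_ter \<phi>\<^sub>1 (D_op1 br \<rho> \<phi> \<sigma> \<omega>\<^sub>1) \<omega>\<^sub>1) \<in> h \<and>
           (sd_bin \<phi>' \<sigma>', sd_ter \<phi>\<^sub>1' (D_op1 br \<rho> \<phi>' \<sigma>' \<omega>\<^sub>1') \<omega>\<^sub>1') \<in> h"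
proof -
  let ?L = "module_prod.scale sg sv" and ?B = "sd_bin br \<rho>" and ?T = "sd_ter tr (D_op br \<rho> \<mu>) \<mu>"
  let ?c = "(sd_bin \<phi> \<sigma>, sd_ter \<phi>\<^sub>1 (D_op1 br \<rho> \<phi> \<sigma> \<omega>\<^sub>1) \<omega>\<^sub>1)"
    and ?c' = "(sd_bin \<phi>' \<sigma>', sd_ter \<phi>\<^sub>1' (D_op1 br \<rho> \<phi>' \<sigma>' \<omega>\<^sub>1') \<omega>\<^sub>1')"
  interpret u: lieyrep_deformation sg sv br tr \<rho> \<mu> \<phi> \<phi>\<^sub>1 \<phi>\<^sub>2 \<sigma> \<omega>\<^sub>1 \<omega>\<^sub>2
    using assms(3-5) by unfold_locales (simp_all add: lieyrep_pair_def)
  interpret u': lieyrep_deformation sg sv br tr \<rho> \<mu> \<phi>' \<phi>\<^sub>1' \<phi>\<^sub>2' \<sigma>' \<omega>\<^sub>1' \<omega>\<^sub>2'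
    using assms(6) by unfold_locales
  interpret vector_space_prod sg sv
    using assms(1,2)
    by (simp add: vector_space_prod_def vector_space_pair_def finite_dimensional_vector_space_def)
  obtain N S where N: "Vector_Spaces.linear sg sg N" and S: "Vector_Spaces.linear sv sv S"
    and hom: "\<And>t. lieyrep_hom
              sg sv (deform1 sg br \<phi>' t) (deform2 sg tr \<phi>\<^sub>1' \<phi>\<^sub>2' t)
                    (deform1 sv \<rho> \<sigma>' t) (deform2 sv \<mu> \<omega>\<^sub>1' \<omega>\<^sub>2' t)
              sg sv (deform1 sg br \<phi> t) (deform2 sg tr \<phi>\<^sub>1 \<phi>\<^sub>2 t)
                    (deform1 sv \<rho> \<sigma> t) (deform2 sv \<mu> \<omega>\<^sub>1 \<omega>\<^sub>2 t)
              (\<lambda>x. x + sg t (N x)) (\<lambda>v. v + sv t (S v))"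
    using assms(7) unfolding equivalent_deformations_def by blast
  let ?M = "map_prod N S"
  have M: "Vector_Spaces.linear ?L ?L ?M"
    using N S u.L.vector_space_axioms by (auto simp: Vector_Spaces.linear_iff scale_prod)
  \<comment> \<open>The homomorphism of pairs acts on the semidirect product as \<open>Id + tM\<close>.\<close>
  have shift: "map_prod (\<lambda>x. x + sg t (N x)) (\<lambda>v. v + sv t (S v)) a = a + ?L t (?M a)" for t a
    by (cases a) (simp add: scale_prod)
  have "?c' - ?c = cobd1 ?B ?T ?M"
  proof (rule u.L.equivalent_deformations_coboundary[OF u.lie_yamaguti_semidirect
        u.multilinear_cochains(1) u'.multilinear_cochains(1) u.multilinear_cochains(2)
        u'.multilinear_cochains(2) u.multilinear_cochains(3) u'.multilinear_cochains(3) M])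
    note lift = lieyrep_hom_semidirect[OF hom,
        unfolded shift u.sd_ter_deform[OF u.generators(4)] u.sd_bin_deform[OF u.generators(4)]
          u.sd_ter_deform[OF u'.generators(4)] u.sd_bin_deform[OF u'.generators(4)]]
    show "deform1 ?L ?B (sd_bin \<phi>' \<sigma>') t a b + ?L t (?M (deform1 ?L ?B (sd_bin \<phi>' \<sigma>') t a b))
        = deform1 ?L ?B (sd_bin \<phi> \<sigma>) t (a + ?L t (?M a)) (b + ?L t (?M b))" for t a b
      by (rule lift(1))
    show "deform2 ?L ?T u'.T\<^sub>1 u'.T\<^sub>2 t a b c + ?L t (?M (deform2 ?L ?T u'.T\<^sub>1 u'.T\<^sub>2 t a b c))
        = deform2 ?L ?T u.T\<^sub>1 u.T\<^sub>2 t (a + ?L t (?M a)) (b + ?L t (?M b)) (c + ?L t (?M c))" for t a b c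
      by (rule lift(2))
  qed
  \<comment> \<open>The primed cocycle serves as representative because this difference is the one that is
    visibly a coboundary.\<close>
  then have diff: "?c' - ?c \<in> B2_pair sg sv br tr \<rho> \<mu>"
    using N S unfolding B2_pair_def C1_pair_def by blast
  have "0 \<in> B2_pair sg sv br tr \<rho> \<mu>"
  proof -
    have "Vector_Spaces.linear sg sg (\<lambda>x. 0)" "Vector_Spaces.linear sv sv (\<lambda>v. 0)"
      using N S by (simp_all add: Vector_Spaces.linear_iff)
    then have mem: "map_prod (\<lambda>x. 0) (\<lambda>v. 0) \<in> C1_pair sg sv"
      unfolding C1_pair_def by blast
    have eq: "map_prod (\<lambda>x. 0) (\<lambda>v. 0) = (\<lambda>a. 0 :: 'a \<times> 'v)"
      by (simp add: fun_eq_iff zero_prod_def)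
    have "(\<lambda>a. 0) \<in> C1_pair sg sv"
      using mem unfolding eq .
    moreover have "0 = cobd1 ?B ?T (\<lambda>a. 0)"
      unfolding cobd1_def bilinear_map_simps(6)[OF lie_yamagutiD(1)[OF u.lie_yamaguti_semidirect]]
        trilinear_map_simps(7,9)[OF lie_yamagutiD(2)[OF u.lie_yamaguti_semidirect]]
      by (simp add: zero_prod_def fun_eq_iff)
    ultimately show ?thesis
      unfolding B2_pair_def by (intro image_eqI)
  qed
  with diff u.cocycle u'.cocycle
  have "?c \<in> cohomologous sg sv br tr \<rho> \<mu> `` {?c'}" "?c' \<in> cohomologous sg sv br tr \<rho> \<mu> `` {?c'}"
    by (simp_all only: cohomologous_def Image_singleton_iff mem_Collect_eq case_prod_conv diff_self)
  moreover have "cohomologous sg sv br tr \<rho> \<mu> `` {?c'} \<in> H2_pair sg sv br tr \<rho> \<mu>"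
    unfolding H2_pair_def using u'.cocycle by (rule quotientI)
  ultimately show ?thesis
    by blast
qed

end
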